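(* Let $M \ge 2$ be an integer, let $\mathcal A \subset \{0, \dots, M-1\}$ be nonempty, and let $\chi \in C_c^\infty((0,1);[0,1])$. Let $B_N$ be the associated quantum open baker's map and $\mathcal N_N(\nu)$ its eigenvalue counting function, and put $\delta = \frac{\log |\mathcal A|}{\log M}$. Then for each $\nu > 0$ there is a constant $C$ (independent of $N$) such that, as $N = KM \to \infty$ with $K \in \mathbb N$, $$\mathcal N_N(\nu) \le C N^\delta ,$$ i.e. $\mathcal N_N(\nu) = \mathcal O(N^\delta)$.
   Context: For $N \in \mathbb N$, $\mathbb Z_N = \mathbb Z/N\mathbb Z \simeq \{0,\dots,N-1\}$ and $\ell^2_N = \ell^2(\mathbb Z_N)$ with norm $\|u\|^2 = \sum_{j=0}^{N-1}|u(j)|^2$. The unitary discrete Fourier transform is $\mathcal F_N u(j) = N^{-1/2}\sum_{\ell=0}^{N-1} e^{-2\pi i j\ell/N} u(\ell)$. For a function $\varphi$ on $[0,1]$, its discretization $\varphi_N \in \ell^2_N$ is $\varphi_N(j) = \varphi(j/N)$, also viewed as the multiplication operator by $\varphi_N$ on $\ell^2_N$. Let $N = KM$ with $K \in \mathbb N$. For $a \in \{0,\dots,M-1\}$ define $\Pi_a : \ell^2_N \to \ell^2_K$ by $\Pi_a u(j) = u(j + aK)$, $j \in \{0,\dots,K-1\}$. The quantum open baker's map is the operator on $\ell^2_N$ $$B_N = \sum_{a \in \mathcal A} \mathcal F_N^* \Pi_a^* \chi_K \mathcal F_K \chi_K \Pi_a,$$ where $\chi_K$ is multiplication by $j \mapsto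 \chi(j/K)$ on $\ell^2_K$. For $\nu \ge 0$, $\mathcal N_N(\nu)$ is the number of eigenvalues $\lambda$ of $B_N$ with $|\lambda| \ge M^{-\nu}$, counted with multiplicity. *)

theory Defs
  imports "HOL-Analysis.Analysis" "Jordan_Normal_Form.Char_Poly" "Jordan_Normal_Form.Schur_Decomposition"
begin

definition smooth_fun :: "(real \<Rightarrow> real) \<Rightarrow> bool" where
  "smooth_fun f \<longleftrightarrow> (\<forall>k. (\<lambda>x. ((deriv ^^ k) f) x) differentiable_on UNIV)"

definition cutoff01 :: "(real \<Rightarrow> real) \<Rightarrow> bool" where
  "cutoff01 chi \<longleftrightarrow> smooth_fun chi \<and> (\<forall>x. 0 \<le> chi x \<and> chi x \<le> 1) \<and>
     (\<exists>a b. 0 < a \<and> b < 1 \<and> (\<forall>x. x \<notin> {a..b} \<longrightarrow> chi x = 0))"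

definition DFT :: "nat \<Rightarrow> complex mat" where
  "DFT N = mat N N (\<lambda>(j,l). exp (- 2 * pi * \<i> * of_nat j * of_nat l / of_nat N) / of_real (sqrt (real N)))"

definition Proj :: "nat \<Rightarrow> nat \<Rightarrow> nat \<Rightarrow> complex mat" where
  "Proj K N a = mat K N (\<lambda>(j,l). if l = j + a * K then 1 else 0)"

definition chi_mult :: "(real \<Rightarrow> real) \<Rightarrow> nat \<Rightarrow> complex mat" where
  "chi_mult chi K = mat K K (\<lambda>(i,j). if i = j then complex_of_real (chi (real j / real K)) else 0)"

definition baker_term :: "nat \<Rightarrow> (real \<Rightarrow> real) \<Rightarrow> nat \<Rightarrow> nat \<Rightarrow> complex mat" where
  "baker_term M chi K a =
     mat_adjoint (DFT (K * M)) * mat_adjoint (Proj K (K * M) a) * chi_mult chi K * DFT K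
       * chi_mult chi K * Proj K (K * M) a"

definition baker :: "nat \<Rightarrow> nat set \<Rightarrow> (real \<Rightarrow> real) \<Rightarrow> nat \<Rightarrow> complex mat" where
  "baker M \<A> chi K = mat (K * M) (K * M) (\<lambda>ij. \<Sum>a\<in>\<A>. baker_term M chi K a $$ ij)"

definition eig_count :: "nat \<Rightarrow> nat set \<Rightarrow> (real \<Rightarrow> real) \<Rightarrow> nat \<Rightarrow> real \<Rightarrow> nat" where
  "eig_count M \<A> chi K \<nu> =
     (\<Sum>z\<in>{z. eigenvalue (baker M \<A> chi K) z \<and> cmod z \<ge> real M powr (- \<nu>)}.
        Polynomial.order z (char_poly (baker M \<A> chi K)))"

end

theory Submission
  imports Defs "HOL-Complex_Analysis.Conformal_Mappings"
begin

text \<open>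
  The entries of the baker's map in the column \<open>j = l + a K\<close> decay rapidly, uniformly in \<open>K\<close>, in the
  distance from the row index to \<open>M l\<close>, the image of \<open>j\<close> under the expanding map \<open>x \<mapsto> M x - a N\<close>.
  Let \<open>d\<close> be \<open>N\<close> times the distance from \<open>j / N\<close> to the Cantor set. It is 1-Lipschitz and the
  expanding map increases it by at least the factor \<open>M\<close>. Hence, in the \<open>\<ell>\<^sup>1\<close> norm with weight \<open>(R + d)\<^bsup>-s\<^esup>\<close>,
  all columns are bounded and those with \<open>d > R\<close> are as small as desired once \<open>s\<close> is large, with \<open>R\<close>
  large depending on \<open>s\<close>. Only \<open>O(N\<^sup>\<delta>)\<close> columns have \<open>d \<le> R\<close>, and a matrix with \<open>m\<close> bounded columns and
  small remaining ones has \<open>O(m)\<close> eigenvalues away from zero, by a Jensen type argument for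
  \<open>det (1 - z A)\<close>. No \<open>\<epsilon>\<close> is lost because the weight acts in a single step of the map.
\<close>

subsection \<open>Counting eigenvalues by weighted column sums\<close>

text \<open>The product of the column sums expands into a sum over all choices of one row per
  column, and the permutations of the Leibniz formula are among these choices. For a permutation the
  weights cancel, since numerators and denominators run over the same values.\<close>

lemma cmod_det_le_weighted_column_sums:
  fixes X :: "complex mat" and w :: "nat \<Rightarrow> real"
  assumes X: "X \<in> carrier_mat n n" and w: "\<And>i. i < n \<Longrightarrow> w i > 0"
  shows "cmod (det X) \<le> (\<Prod>j<n. (\<Sum>i<n. cmod (X $$ (i,j)) * w i) / w j)"
proof -
  let ?Y = "\<lambda>i j. cmod (X $$ (i,j)) * w i / w j"
  let ?P = "{p. p permutes {0..<n}}"
  have "det X = det (transpose_mat X)"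
    using det_transpose[OF X] by simp
  also have "\<dots> = (\<Sum>p\<in>?P. signof p * (\<Prod>i=0..<n. X $$ (p i, i)))"
  proof -
    have "(\<Prod>i=0..<n. transpose_mat X $$ (i, p i)) = (\<Prod>i=0..<n. X $$ (p i, i))" if "p \<in> ?P" for p
      using X that permutes_in_image[of p "{0..<n}"] by (intro prod.cong) auto
    then show ?thesis
      by (subst det_def'[of _ n]) (use X in \<open>auto intro!: sum.cong\<close>)
  qed
  finally have "cmod (det X) \<le> (\<Sum>p\<in>?P. cmod (signof p * (\<Prod>i=0..<n. X $$ (p i, i))))"
    by (simp only: norm_sum)
  also have "\<dots> = (\<Sum>p\<in>?P. \<Prod>i=0..<n. ?Y (p i) i)"
  proof (rule sum.cong[OF refl])
    fix p assume p: "p \<in> ?P"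
    have "(\<Prod>i=0..<n. w (p i)) = (\<Prod>i=0..<n. w i)"
      using p by (simp add: prod.permute[of p "{0..<n}" w] o_def)
    moreover have "(\<Prod>i=0..<n. w i) \<noteq> 0"
      using w by (auto simp: less_imp_neq[symmetric])
    moreover have "cmod (signof p) = 1"
      by (simp add: sign_def)
    ultimately show "cmod (signof p * (\<Prod>i=0..<n. X $$ (p i, i))) = (\<Prod>i=0..<n. ?Y (p i) i)"
      by (simp add: norm_mult prod_norm[symmetric] prod.distrib prod_dividef)
  qed
  \<comment> \<open>A permutation is the identity outside \<open>{0..<n}\<close>, so restricting it
    loses nothing and places it in the extensional function space over which a product of sums
    expands.\<close>
  also have "\<dots> = (\<Sum>f\<in>(\<lambda>p. restrict p {0..<n}) ` ?P. \<Prod>i=0..<n. ?Y (f i) i)"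
  proof (subst sum.reindex)
    show "inj_on (\<lambda>p. restrict p {0..<n}) ?P"
    proof (rule inj_onI, rule ext)
      fix p q x assume pq: "p \<in> ?P" "q \<in> ?P" and e: "restrict p {0..<n} = restrict q {0..<n}"
      have "restrict p {0..<n} x = restrict q {0..<n} x"
        by (simp only: e)
      then show "p x = q x"
        using pq permutes_not_in[of p "{0..<n}" x] permutes_not_in[of q "{0..<n}" x]
        by (cases "x < n") simp_all
    qed
  qed auto
  also have "\<dots> \<le> (\<Sum>f\<in>Pi\<^sub>E {0..<n} (\<lambda>_. {..<n}). \<Prod>i=0..<n. ?Y (f i) i)"
  proof (rule sum_mono2)
    show "finite (Pi\<^sub>E {0..<n} (\<lambda>_. {..<n}))"
      by (intro finite_PiE) auto
    show "(\<lambda>p. restrict p {0..<n}) ` ?P \<subseteq> Pi\<^sub>E {0..<n} (\<lambda>_. {..<n})"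
      using permutes_in_image by fastforce
    show "0 \<le> (\<Prod>i=0..<n. ?Y (f i) i)"
      if "f \<in> Pi\<^sub>E {0..<n} (\<lambda>_. {..<n}) - (\<lambda>p. restrict p {0..<n}) ` ?P" for f
    proof (intro prod_nonneg ballI)
      fix i assume i: "i \<in> {0..<n}"
      then have "f i < n" using that by (auto simp: PiE_iff)
      then show "0 \<le> ?Y (f i) i" using w[of i] w[of "f i"] i by auto
    qed
  qed
  also have "\<dots> = (\<Prod>j=0..<n. \<Sum>i<n. ?Y i j)"
    by (rule prod_sum_PiE[symmetric]) auto
  finally show ?thesis
    by (simp add: sum_divide_distrib atLeast0LessThan)
qed

text \<open>In the weighted norm the column bounds make \<open>z * B\<close> a contraction by 1/2,
  so its contribution can be absorbed on the left. With \<open>a = 0\<close> this gives injectivity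
  of \<open>1 - z * B\<close>; with \<open>a\<close> a column of the right-hand side it bounds the
  solution without a Neumann series.\<close>

lemma weighted_resolvent_estimate:
  fixes B :: "complex mat" and x a :: "nat \<Rightarrow> complex" and w :: "nat \<Rightarrow> real"
  assumes w: "\<And>i. i < n \<Longrightarrow> w i > 0"
    and B: "\<And>j. j < n \<Longrightarrow> (\<Sum>i<n. cmod (B $$ (i,j)) * w i) \<le> \<rho> * w j"
    and z: "cmod z * \<rho> \<le> 1/2"
    and x: "\<And>i. i < n \<Longrightarrow> x i = a i + z * (\<Sum>k<n. B $$ (i,k) * x k)"
  shows "(\<Sum>i<n. cmod (x i) * w i) \<le> 2 * (\<Sum>i<n. cmod (a i) * w i)"
proof -
  have "(\<Sum>i<n. cmod (x i) * w i)
      \<le> (\<Sum>i<n. cmod (a i) * w i + cmod z * (\<Sum>k<n. cmod (B $$ (i,k)) * cmod (x k) * w i))"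
  proof (rule sum_mono)
    fix i assume i: "i \<in> {..<n}"
    have "cmod (x i) \<le> cmod (a i) + cmod z * (\<Sum>k<n. cmod (B $$ (i,k)) * cmod (x k))"
      unfolding x[of i, OF i[unfolded lessThan_iff]]
      by (rule norm_triangle_le) (auto simp: norm_mult intro!: mult_left_mono order_trans[OF norm_sum])
    then have "cmod (x i) * w i \<le> (cmod (a i) + cmod z * (\<Sum>k<n. cmod (B $$ (i,k)) * cmod (x k))) * w i"
      using w[of i] i by (intro mult_right_mono) auto
    then show "cmod (x i) * w i \<le> cmod (a i) * w i + cmod z * (\<Sum>k<n. cmod (B $$ (i,k)) * cmod (x k) * w i)"
      by (simp add: algebra_simps sum_distrib_left)
  qed
  also have "\<dots> = (\<Sum>i<n. cmod (a i) * w i)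
      + cmod z * (\<Sum>k<n. cmod (x k) * (\<Sum>i<n. cmod (B $$ (i,k)) * w i))"
    unfolding sum.distrib sum_distrib_left[symmetric]
    by (subst sum.swap) (simp add: sum_distrib_left algebra_simps)
  also have "\<dots> \<le> (\<Sum>i<n. cmod (a i) * w i) + cmod z * (\<Sum>k<n. cmod (x k) * (\<rho> * w k))"
    by (intro add_left_mono mult_left_mono sum_mono B) auto
  also have "cmod z * (\<Sum>k<n. cmod (x k) * (\<rho> * w k)) = (cmod z * \<rho>) * (\<Sum>k<n. cmod (x k) * w k)"
    by (simp add: sum_distrib_left algebra_simps)
  also have "\<dots> \<le> 1/2 * (\<Sum>k<n. cmod (x k) * w k)"
    using z w by (intro mult_right_mono sum_nonneg) (auto simp: less_imp_le)
  finally show ?thesis by simp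
qed

section \<open>Eigenvalues with multiplicity as a list of roots\<close>

lemma poly_prod_list_linear:
  "poly (\<Prod>e\<leftarrow>es. [:- e, 1:]) x = (\<Prod>e\<leftarrow>es. x - e)" for x :: "'a :: comm_ring_1"
  by (induction es) (auto simp: algebra_simps)

text \<open>Pulling out \<open>z\<close> leaves \<open>1 / z - A\<close>, so this is the reversed
  characteristic polynomial.\<close>

lemma det_one_minus_smult_factorized:
  fixes A :: "complex mat"
  assumes A: "A \<in> carrier_mat n n" and es: "char_poly A = (\<Prod>e\<leftarrow>es. [:- e, 1:])"
    and n: "length es = n" and z: "z \<noteq> 0"
  shows "det (1\<^sub>m n - z \<cdot>\<^sub>m A) = (\<Prod>e\<leftarrow>es. 1 - z * e)"
proof -
  have "1\<^sub>m n - z \<cdot>\<^sub>m A = z \<cdot>\<^sub>m (- char_matrix A (1 / z))"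
    using A z by (intro eq_matI) (auto simp: char_matrix_def field_simps)
  then have "det (1\<^sub>m n - z \<cdot>\<^sub>m A) = z ^ n * poly (char_poly A) (1 / z)"
    using A by (simp add: char_poly_matrix[OF A] char_matrix_def)
  also have "\<dots> = z ^ length es * (\<Prod>e\<leftarrow>es. 1 / z - e)"
    by (simp add: es poly_prod_list_linear n)
  also have "\<dots> = (\<Prod>e\<leftarrow>es. 1 - z * e)"
    using z by (induction es) (auto simp: field_simps)
  finally show ?thesis .
qed

lemma holomorphic_det_one_minus_smult:
  fixes B :: "complex mat"
  assumes B: "B \<in> carrier_mat n n"
  shows "(\<lambda>z. det (1\<^sub>m n - z \<cdot>\<^sub>m B)) holomorphic_on U"
proof -
  have "det (1\<^sub>m n - z \<cdot>\<^sub>m B) = (\<Sum>p\<in>{p. p permutes {0..<n}}.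
      signof p * (\<Prod>i=0..<n. 1\<^sub>m n $$ (i, p i) - z * B $$ (i, p i)))"
    (is "det ?C = _") for z
  proof -
    have C: "?C \<in> carrier_mat n n" using B by auto
    show ?thesis
      unfolding det_def'[OF C]
    proof (intro sum.cong refl arg_cong2[where f="(*)"] prod.cong)
      fix p i assume "p \<in> {p. p permutes {0..<n}}" "i \<in> {0..<n}"
      then have "p i < n" "i < n" using permutes_in_image[of p "{0..<n}" i] by auto
      then show "(1\<^sub>m n - z \<cdot>\<^sub>m B) $$ (i, p i) = 1\<^sub>m n $$ (i, p i) - z * B $$ (i, p i)"
        using B by auto
    qed
  qed
  then show ?thesis
    by (auto intro!: holomorphic_intros)
qed

text \<open>Root multiplicities become repetitions in a list, so that the eigenvalue count is a
  number of factors in a product.\<close>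

lemma sum_order_prod_list_linear:
  fixes es :: "'a :: idom list"
  shows "(\<Sum>z\<in>{z\<in>set es. P z}. Polynomial.order z (\<Prod>e\<leftarrow>es. [:- e, 1:])) = length (filter P es)"
proof -
  have "Polynomial.order z (\<Prod>e\<leftarrow>es. [:- e, 1:]) = count_list es z" for z
  proof (induction es)
    case (Cons e es)
    have nz: "(\<Prod>e\<leftarrow>es. [:- e, 1:]) \<noteq> 0" for es :: "'a list"
      by (induction es) (simp_all del: mult_pCons_left)
    have "Polynomial.order z [:- e, 1:] = (if e = z then 1 else 0)"
      using order_linear_power[of z "- e" 1] by simp
    then show ?case
      using Cons nz[of es] by (simp add: order_mult del: mult_pCons_left)
  qed simp
  then have "(\<Sum>z\<in>{z\<in>set es. P z}. Polynomial.order z (\<Prod>e\<leftarrow>es. [:- e, 1:]))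
      = (\<Sum>z\<in>set (filter P es). count_list (filter P es) z)"
    by (intro sum.cong) (auto simp: count_list_eq_length_filter intro!: arg_cong[of _ _ length] filter_cong)
  then show ?thesis
    by (simp add: sum_count_set)
qed

text \<open>On \<^term>\<open>cmod z = 3 / r\<close> the quotient of \<^term>\<open>det (1\<^sub>m n - z \<cdot>\<^sub>m A)\<close> by
  the zero-free \<^term>\<open>det (1\<^sub>m n - z \<cdot>\<^sub>m B)\<close>, where \<^term>\<open>B\<close> is \<^term>\<open>A\<close> with the columns
  in \<^term>\<open>S\<close> erased, is the determinant of a perturbation of the identity in the columns in
  \<^term>\<open>S\<close> only. Dividing out the factors of the large eigenvalues, each at least 2 in modulus there,
  the maximum principle compares with the value 1 at the origin.\<close>

lemma eigenvalue_count_le: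
  fixes A :: "complex mat" and w :: "nat \<Rightarrow> real"
  assumes A: "A \<in> carrier_mat n n"
    and w: "\<And>i. i < n \<Longrightarrow> w i > 0"
    and S: "S \<subseteq> {..<n}"
    and G: "\<And>j. j < n \<Longrightarrow> (\<Sum>i<n. cmod (A $$ (i,j)) * w i) \<le> G * w j"
    and small: "\<And>j. j < n \<Longrightarrow> j \<notin> S \<Longrightarrow> (\<Sum>i<n. cmod (A $$ (i,j)) * w i) \<le> r / 6 * w j"
    and r: "r > 0"
  shows "2 ^ (\<Sum>z\<in>{z. eigenvalue A z \<and> cmod z \<ge> r}. Polynomial.order z (char_poly A))
    \<le> (1 + 6 * G / r) ^ card S"
proof -
  obtain es where es: "char_poly A = (\<Prod>e\<leftarrow>es. [:- e, 1:])" and n: "length es = n"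
    using char_poly_factorized[OF A] by blast
  define big where "big = filter (\<lambda>e. cmod e \<ge> r) es"
  define rest where "rest = filter (\<lambda>e. \<not> cmod e \<ge> r) es"
  have "eigenvalue A z \<longleftrightarrow> z \<in> set es" for z
    unfolding eigenvalue_root_char_poly[OF A] es poly_prod_list_linear
    by (auto simp: prod_list_zero_iff)
  then have cnt: "(\<Sum>z\<in>{z. eigenvalue A z \<and> cmod z \<ge> r}. Polynomial.order z (char_poly A)) = length big"
    by (simp add: es sum_order_prod_list_linear big_def)
  define B where "B = mat n n (\<lambda>(i,j). if j \<in> S then 0 else A $$ (i,j))"
  define A1 where "A1 = mat n n (\<lambda>(i,j). if j \<in> S then A $$ (i,j) else 0)"
  have B: "B \<in> carrier_mat n n" and A1: "A1 \<in> carrier_mat n n"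
    by (auto simp: B_def A1_def)
  have Bcol: "(\<Sum>i<n. cmod (B $$ (i,j)) * w i) \<le> r / 6 * w j" if "j < n" for j
    using small[OF that] w[OF that] r that by (cases "j \<in> S") (auto simp: B_def)
  let ?D = "\<lambda>z. 1\<^sub>m n - z \<cdot>\<^sub>m B"
  have D: "?D z \<in> carrier_mat n n" for z
    using B by auto
  \<comment> \<open>The radius \<open>3 / r\<close> serves twice: with the column bound
    \<open>r / 6\<close> it gives contraction by 1/2, and on the circle an eigenvalue of modulus at
    least \<open>r\<close> gives \<open>cmod (z * e) \<ge> 3\<close>.\<close>
  have half: "cmod z * (r / 6) \<le> 1 / 2" if "cmod z \<le> 3 / r" for z
    using that r by (simp add: field_simps)
  have nonzero: "det (?D z) \<noteq> 0" if z: "cmod z \<le> 3 / r" for z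
  proof
    assume "det (?D z) = 0"
    then obtain v where v: "v \<in> carrier_vec n" "v \<noteq> 0\<^sub>v n" "?D z *\<^sub>v v = 0\<^sub>v n"
      using det_0_iff_vec_prod_zero[OF D] by blast
    have "v $ i = 0 + z * (\<Sum>k<n. B $$ (i,k) * v $ k)" if i: "i < n" for i
    proof -
      have "0 = (?D z *\<^sub>v v) $ i"
        using v i by simp
      also have "\<dots> = (\<Sum>k<n. (if i = k then v $ k else 0) - z * (B $$ (i,k) * v $ k))"
        using B v(1) i by (auto simp: scalar_prod_def atLeast0LessThan algebra_simps intro!: sum.cong)
      also have "\<dots> = v $ i - z * (\<Sum>k<n. B $$ (i,k) * v $ k)"
        using i by (simp add: sum_subtractf sum_distrib_left)
      finally show ?thesis by simp
    qed
    from weighted_resolvent_estimate[OF w Bcol half[OF z] this]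
    have le0: "(\<Sum>i<n. cmod (v $ i) * w i) \<le> 0" by simp
    have nn: "\<forall>i\<in>{..<n}. 0 \<le> cmod (v $ i) * w i"
      using w by (auto simp: less_imp_le)
    have "(\<Sum>i<n. cmod (v $ i) * w i) = 0"
      using le0 sum_nonneg[of "{..<n}" "\<lambda>i. cmod (v $ i) * w i"] nn by force
    then have "cmod (v $ i) * w i = 0" if "i < n" for i
      using nn sum_nonneg_eq_0_iff[of "{..<n}" "\<lambda>i. cmod (v $ i) * w i"] that by auto
    then have "v $ i = 0" if "i < n" for i
      using w[OF that] that by fastforce
    then show False
      using v by (auto simp: vec_eq_iff)
  qed
  have quotient: "cmod (det (1\<^sub>m n - z \<cdot>\<^sub>m A)) \<le> cmod (det (?D z)) * (1 + 6 * G / r) ^ card S"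
    if z: "cmod z = 3 / r" for z
  proof -
    have z': "cmod z \<le> 3 / r" using z by simp
    obtain Y where Y: "Y \<in> carrier_mat n n" "?D z * Y = 1\<^sub>m n"
      using det_non_zero_imp_unit[OF D nonzero[OF z'], of undefined]
      by (auto simp: Units_def ring_mat_simps)
    \<comment> \<open>This is the inverse of \<open>?D z\<close> applied to \<open>A1\<close>, so
      that \<open>1 - z * A\<close> factors as \<open>?D z\<close> times \<open>1 - z * X\<close>.
      Columns of \<open>X\<close> outside \<open>S\<close> vanish because those of \<open>A1\<close>
      do.\<close>
    define X where "X = Y * A1"
    have X: "X \<in> carrier_mat n n"
      using Y A1 by (simp add: X_def)
    have DX: "?D z * X = A1"
      unfolding X_def using Y A1 D[of z] by (simp flip: assoc_mult_mat)
    have "X $$ (i,j) = A1 $$ (i,j) + z * (\<Sum>k<n. B $$ (i,k) * X $$ (k,j))" if i: "i < n" and j: "j < n" for i j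
    proof -
      have "A1 $$ (i,j) = (?D z * X) $$ (i,j)"
        by (simp add: DX)
      also have "\<dots> = (\<Sum>k<n. (if i = k then X $$ (k,j) else 0) - z * (B $$ (i,k) * X $$ (k,j)))"
        using B X i j by (auto simp: scalar_prod_def atLeast0LessThan algebra_simps intro!: sum.cong)
      also have "\<dots> = X $$ (i,j) - z * (\<Sum>k<n. B $$ (i,k) * X $$ (k,j))"
        using i by (simp add: sum_subtractf sum_distrib_left)
      finally show ?thesis by simp
    qed
    from weighted_resolvent_estimate[OF w Bcol half[OF z'] this]
    have Xcol: "(\<Sum>i<n. cmod (X $$ (i,j)) * w i) \<le> 2 * (\<Sum>i<n. cmod (A1 $$ (i,j)) * w i)" if "j < n" for j
      using that by blast
    have "(1\<^sub>m n - z \<cdot>\<^sub>m A) = ?D z * (1\<^sub>m n - z \<cdot>\<^sub>m X)"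
    proof -
      have "?D z * (1\<^sub>m n - z \<cdot>\<^sub>m X) = ?D z - z \<cdot>\<^sub>m A1"
        using X B D[of z] DX
        by (subst mult_minus_distrib_mat[of _ n n _ n]) (auto simp: mult_smult_distrib[OF D X])
      also have "\<dots> = 1\<^sub>m n - z \<cdot>\<^sub>m A"
        using A by (intro eq_matI) (auto simp: B_def A1_def)
      finally show ?thesis by simp
    qed
    then have "det (1\<^sub>m n - z \<cdot>\<^sub>m A) = det (?D z) * det (1\<^sub>m n - z \<cdot>\<^sub>m X)"
      using det_mult[OF D[of z] minus_carrier_mat[OF smult_carrier_mat[OF X]]] by simp
    moreover have "cmod (det (1\<^sub>m n - z \<cdot>\<^sub>m X)) \<le> (1 + 6 * G / r) ^ card S"
    proof -
      have "cmod (det (1\<^sub>m n - z \<cdot>\<^sub>m X))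
          \<le> (\<Prod>j<n. (\<Sum>i<n. cmod ((1\<^sub>m n - z \<cdot>\<^sub>m X) $$ (i,j)) * w i) / w j)"
        by (rule cmod_det_le_weighted_column_sums) (use X w in auto)
      also have "\<dots> \<le> (\<Prod>j<n. if j \<in> S then 1 + 6 * G / r else 1)"
      proof (intro prod_mono conjI)
        fix j assume "j \<in> {..<n}"
        then have j: "j < n" by simp
        show "0 \<le> (\<Sum>i<n. cmod ((1\<^sub>m n - z \<cdot>\<^sub>m X) $$ (i,j)) * w i) / w j"
          using w j by (intro divide_nonneg_nonneg sum_nonneg mult_nonneg_nonneg) (auto simp: less_imp_le)
        have "(\<Sum>i<n. cmod ((1\<^sub>m n - z \<cdot>\<^sub>m X) $$ (i,j)) * w i)
            \<le> (\<Sum>i<n. (if i = j then w i else 0) + cmod z * (cmod (X $$ (i,j)) * w i))"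
        proof (rule sum_mono)
          fix i assume "i \<in> {..<n}"
          then have i: "i < n" by simp
          have "cmod ((1\<^sub>m n - z \<cdot>\<^sub>m X) $$ (i,j)) \<le> (if i = j then 1 else 0) + cmod z * cmod (X $$ (i,j))"
            using i j X norm_triangle_ineq4[of 1 "z * X $$ (i,j)"] by (auto simp: norm_mult)
          from mult_right_mono[OF this, of "w i"]
          show "cmod ((1\<^sub>m n - z \<cdot>\<^sub>m X) $$ (i,j)) * w i
              \<le> (if i = j then w i else 0) + cmod z * (cmod (X $$ (i,j)) * w i)"
            using w[OF i] by (auto simp: algebra_simps split: if_splits)
        qed
        also have "\<dots> = w j + cmod z * (\<Sum>i<n. cmod (X $$ (i,j)) * w i)"
          using j by (simp add: sum.distrib sum_distrib_left)
        also have "\<dots> \<le> w j + cmod z * (2 * (\<Sum>i<n. cmod (A1 $$ (i,j)) * w i))"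
          using Xcol[OF j] by (intro add_left_mono mult_left_mono) auto
        also have "\<dots> \<le> w j + cmod z * (2 * (if j \<in> S then G * w j else 0))"
          using G[OF j] j by (intro add_left_mono mult_left_mono) (auto simp: A1_def)
        \<comment> \<open>The constant \<open>6 * G / r\<close> is the product of the radius
          \<open>3 / r\<close>, the factor 2 of the resolvent estimate and the column bound
          \<open>G\<close>.\<close>
        also have "\<dots> = (if j \<in> S then 1 + 6 * G / r else 1) * w j"
          using z r by (auto simp: field_simps)
        finally show "(\<Sum>i<n. cmod ((1\<^sub>m n - z \<cdot>\<^sub>m X) $$ (i,j)) * w i) / w j
            \<le> (if j \<in> S then 1 + 6 * G / r else 1)"
          using w[OF j] by (simp add: divide_le_eq)
      qed
      also have "\<dots> = (1 + 6 * G / r) ^ card S"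
        using S by (simp add: prod.If_cases Int_absorb1)
      finally show ?thesis .
    qed
    ultimately show ?thesis
      by (simp add: norm_mult mult_left_mono)
  qed
  \<comment> \<open>Keeping only the factors in \<open>rest\<close> performs the division by the
    large eigenvalue factors beforehand, so no removable singularities arise at the reciprocals of
    those eigenvalues.\<close>
  define h where "h = (\<lambda>z. (\<Prod>e\<leftarrow>rest. 1 - z * e) / det (?D z))"
  have hol: "h holomorphic_on cball 0 (3 / r)"
  proof -
    have "(\<lambda>z. \<Prod>e\<leftarrow>es. 1 - z * e) holomorphic_on cball 0 (3 / r)" for es :: "complex list"
      by (induction es) (auto intro!: holomorphic_intros)
    then show ?thesis
      unfolding h_def
      by (intro holomorphic_on_divide holomorphic_det_one_minus_smult[OF B]) (auto intro!: nonzero)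
  qed
  have "cmod (h 0) \<le> (1 + 6 * G / r) ^ card S / 2 ^ length big"
  proof (rule maximum_modulus_frontier[of h "cball 0 (3 / r)"])
    fix z assume "z \<in> frontier (cball (0::complex) (3 / r))"
    then have z: "cmod z = 3 / r" using r by simp
    then have z0: "z \<noteq> 0" using r by auto
    have "(\<Prod>e\<leftarrow>es. 1 - z * e) = (\<Prod>e\<leftarrow>big. 1 - z * e) * (\<Prod>e\<leftarrow>rest. 1 - z * e)"
      unfolding big_def rest_def by (induction es) auto
    then have "cmod (\<Prod>e\<leftarrow>big. 1 - z * e) * cmod (\<Prod>e\<leftarrow>rest. 1 - z * e)
        \<le> cmod (det (?D z)) * (1 + 6 * G / r) ^ card S"
      using quotient[OF z] det_one_minus_smult_factorized[OF A es n z0] by (simp add: norm_mult)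
    moreover have "2 ^ length big \<le> cmod (\<Prod>e\<leftarrow>big. 1 - z * e)"
    proof -
      have "2 ^ length xs \<le> cmod (\<Prod>e\<leftarrow>xs. 1 - z * e)" if "\<forall>e\<in>set xs. cmod e \<ge> r" for xs
        using that
      proof (induction xs)
        case (Cons e xs)
        have "3 / r * r \<le> cmod z * cmod e"
          using Cons.prems r z by (intro mult_mono) auto
        then have "3 \<le> cmod (z * e)"
          using r by (simp add: norm_mult)
        then have "2 \<le> cmod (1 - z * e)"
          using norm_triangle_ineq3[of "z * e" 1] by (simp add: norm_minus_commute)
        then show ?case
          using Cons by (auto simp: norm_mult intro!: mult_mono)
      qed simp
      then show ?thesis by (simp add: big_def)
    qed
    ultimately have "2 ^ length big * cmod (\<Prod>e\<leftarrow>rest. 1 - z * e)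
        \<le> cmod (det (?D z)) * (1 + 6 * G / r) ^ card S"
      by (meson mult_right_mono norm_ge_zero order_trans)
    then show "cmod (h z) \<le> (1 + 6 * G / r) ^ card S / 2 ^ length big"
      using nonzero[of z] z by (simp add: h_def norm_divide field_simps)
  qed (use hol r in \<open>auto intro: holomorphic_on_subset holomorphic_on_imp_continuous_on\<close>)
  moreover have "h 0 = 1"
  proof -
    have "?D 0 = 1\<^sub>m n"
      using B by (intro eq_matI) auto
    moreover have "(\<Prod>e\<leftarrow>es. 1 - 0 * e) = 1" for es :: "complex list"
      by (induction es) auto
    ultimately show ?thesis
      by (simp add: h_def)
  qed
  ultimately show ?thesis
    unfolding cnt by (simp add: field_simps)
qed

subsection \<open>Decay of the kernel\<close>

text \<open>On the open complement of the support interval every derivative is again zero, and on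
  the compact interval continuity gives the bound. Packaging all derivatives in one sequence lets a
  later induction replace the whole sequence at once.\<close>

lemma cutoff01_derivatives:
  assumes "cutoff01 chi"
  obtains F :: "nat \<Rightarrow> real \<Rightarrow> real" where "F 0 = chi"
    "\<And>k x. (F k has_real_derivative F (Suc k) x) (at x)"
    "\<And>k. \<exists>D\<ge>0. \<forall>x. \<bar>F k x\<bar> \<le> D"
proof -
  define F where "F k = (deriv ^^ k) chi" for k
  obtain a b where ab: "\<And>x. x \<notin> {a..b} \<Longrightarrow> chi x = 0"
    using assms by (auto simp: cutoff01_def)
  have "F k differentiable at x" for k x
    using assms by (auto simp: cutoff01_def smooth_fun_def F_def differentiable_on_def)
  then have der: "(F k has_real_derivative F (Suc k) x) (at x)" for k x
    unfolding DERIV_deriv_iff_real_differentiable[symmetric] by (simp add: F_def)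
  have zero: "F k x = 0" if "x \<notin> {a..b}" for k x
    using that
  proof (induction k arbitrary: x)
    case 0
    then show ?case using ab by (simp add: F_def)
  next
    case (Suc k)
    have "(F k has_real_derivative 0) (at x)"
      by (rule has_field_derivative_transform_within_open[of "\<lambda>_. 0" _ _ "- {a..b}"])
        (use Suc in \<open>auto simp: open_Compl\<close>)
    then show ?case
      using der DERIV_unique by blast
  qed
  have "\<exists>D\<ge>0. \<forall>x. \<bar>F k x\<bar> \<le> D" for k
  proof -
    have "continuous_on {a..b} (F k)"
      using der DERIV_isCont continuous_at_imp_continuous_on by blast
    then have "bounded (F k ` {a..b})"
      by (intro compact_imp_bounded compact_continuous_image) auto
    then obtain D where "\<forall>x\<in>{a..b}. \<bar>F k x\<bar> \<le> D"
      by (auto simp: bounded_iff)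
    then have "\<forall>x. \<bar>F k x\<bar> \<le> max 0 D"
      using zero by (metis abs_zero max.coboundedI1 max.coboundedI2 order_refl)
    then show ?thesis by (intro exI[of _ "max 0 D"]) auto
  qed
  then show ?thesis
    using that[of F] der by (simp add: F_def)
qed

text \<open>The difference is taken backward because multiplying a power sum by
  \<open>1 - \<omega>\<close> subtracts from each coefficient its predecessor.\<close>

definition back_diff :: "real \<Rightarrow> (real \<Rightarrow> real) \<Rightarrow> real \<Rightarrow> real" where
  "back_diff h f x = f x - f (x - h)"

text \<open>Each difference costs a factor \<open>h\<close> by the mean value inequality. The
  induction applies the innermost difference to every \<open>F k\<close>, which yields another
  sequence of successive derivatives.\<close>

lemma abs_back_diff_funpow_le:
  assumes "h \<ge> 0" and "\<And>k x. (F k has_real_derivative F (Suc k) x) (at x)"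
    and "\<And>x. \<bar>F n x\<bar> \<le> D"
  shows "\<bar>(back_diff h ^^ n) (F 0) x\<bar> \<le> h ^ n * D"
  using assms
proof (induction n arbitrary: F D)
  case (Suc n)
  have "\<bar>(back_diff h ^^ n) (back_diff h (F 0)) x\<bar> \<le> h ^ n * (h * D)"
  proof (rule Suc.IH[of "\<lambda>k. back_diff h (F k)"])
    fix k x
    show "(back_diff h (F k) has_real_derivative back_diff h (F (Suc k)) x) (at x)"
      unfolding back_diff_def[abs_def]
      by (auto intro!: derivative_eq_intros DERIV_chain2[OF Suc.prems(2)] Suc.prems(2))
    have "norm (F n x - F n (x - h)) \<le> D * norm (x - (x - h))"
      by (rule field_differentiable_bound[of UNIV "F n" "F (Suc n)"]) (use Suc.prems in auto)
    then show "\<bar>back_diff h (F n) x\<bar> \<le> h * D"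
      using \<open>h \<ge> 0\<close> by (simp add: back_diff_def mult.commute)
  qed fact
  then show ?case
    by (simp only: funpow_Suc_right o_apply) (simp add: algebra_simps)
qed simp

text \<open>There are no boundary terms since \<open>f\<close> vanishes at both ends. Each
  difference lengthens the range by one index, hence \<open>L + n\<close>.\<close>

lemma summation_by_parts:
  fixes \<omega> :: complex
  assumes h: "h > 0" and f: "\<And>x. x \<le> 0 \<or> x \<ge> real L * h \<Longrightarrow> f x = 0"
  shows "(1 - \<omega>) ^ n * (\<Sum>k<L. of_real (f (real k * h)) * \<omega> ^ k)
    = (\<Sum>k<L + n. of_real ((back_diff h ^^ n) f (real k * h)) * \<omega> ^ k)"
  using f
proof (induction n arbitrary: f L)
  case (Suc n)
  let ?t = "\<lambda>k. of_real (f (real k * h)) * \<omega> ^ k"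
  have "(\<Sum>k<Suc L. of_real (back_diff h f (real k * h)) * \<omega> ^ k)
      = (\<Sum>k<Suc L. ?t k) - (\<Sum>k<Suc L. of_real (f (real k * h - h)) * \<omega> ^ k)"
    by (simp only: back_diff_def of_real_diff left_diff_distrib sum_subtractf)
  also have "(\<Sum>k<Suc L. ?t k) = (\<Sum>k<L. ?t k)"
    using Suc.prems by simp
  \<comment> \<open>The term at index 0 is \<open>f (- h)\<close>, which vanishes; the others are
    the original sum shifted by one index.\<close>
  also have "(\<Sum>k<Suc L. of_real (f (real k * h - h)) * \<omega> ^ k) = \<omega> * (\<Sum>k<L. ?t k)"
    unfolding sum.lessThan_Suc_shift using Suc.prems[of "- h"] h
    by (simp add: sum_distrib_left algebra_simps)
  finally have "(\<Sum>k<Suc L. of_real (back_diff h f (real k * h)) * \<omega> ^ k) = (1 - \<omega>) * (\<Sum>k<L. ?t k)"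
    by (simp add: algebra_simps)
  then have "(1 - \<omega>) ^ Suc n * (\<Sum>k<L. ?t k)
      = (1 - \<omega>) ^ n * (\<Sum>k<Suc L. of_real (back_diff h f (real k * h)) * \<omega> ^ k)"
    by simp
  also have "\<dots> = (\<Sum>k<Suc L + n. of_real ((back_diff h ^^ n) (back_diff h f) (real k * h)) * \<omega> ^ k)"
  proof (rule Suc.IH)
    fix x assume x: "x \<le> 0 \<or> real (Suc L) * h \<le> x"
    have "0 \<le> real L * h" using h by simp
    then have "x - h \<le> 0 \<or> real L * h \<le> x - h" "x \<le> 0 \<or> real L * h \<le> x"
      using x h by (auto simp: algebra_simps)
    then show "back_diff h f x = 0"
      using Suc.prems[of x] Suc.prems[of "x - h"] by (simp add: back_diff_def)
  qed
  finally show ?case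
    by (simp only: funpow_Suc_right o_apply) simp
qed simp

text \<open>Summing by parts \<open>n\<close> times at spacing \<open>1 / real K\<close> leaves
  \<open>K + n\<close> terms, each at most \<open>1 / real K ^ n\<close> times the supremum of the
  \<open>n\<close>-th derivative. The constant depends on \<open>chi\<close> and \<open>n\<close>
  only.\<close>

lemma cutoff01_exponential_sum_bound:
  assumes chi: "cutoff01 chi"
  obtains C where "C \<ge> 0" "\<And>K \<omega>. K \<ge> 1 \<Longrightarrow> cmod \<omega> = 1 \<Longrightarrow>
    (real K * cmod (1 - \<omega>)) ^ n * cmod (\<Sum>k<K. of_real (chi (real k / real K)) * \<omega> ^ k) \<le> C * real K"
proof -
  obtain F where F: "F 0 = chi" "\<And>k x. (F k has_real_derivative F (Suc k) x) (at x)"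
    "\<And>k. \<exists>D\<ge>0. \<forall>x. \<bar>F k x\<bar> \<le> D"
    by (rule cutoff01_derivatives[OF chi]) blast
  obtain D where D: "D \<ge> 0" "\<And>x. \<bar>F n x\<bar> \<le> D"
    using F(3)[of n] by blast
  have "(real K * cmod (1 - \<omega>)) ^ n * cmod (\<Sum>k<K. of_real (chi (real k / real K)) * \<omega> ^ k)
      \<le> (1 + real n) * D * real K" if K: "K \<ge> 1" and \<omega>: "cmod \<omega> = 1" for K \<omega>
  proof -
    define h where "h = 1 / real K"
    have h: "h > 0" and Kh: "real K * h = 1"
      using K by (auto simp: h_def)
    have "chi x = 0" if "x \<le> 0 \<or> x \<ge> real K * h" for x
    proof -
      obtain a b where "0 < a" "b < 1" and ab: "\<And>x. x \<notin> {a..b} \<Longrightarrow> chi x = 0"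
        using chi by (auto simp: cutoff01_def)
      then have "x \<notin> {a..b}" using that Kh by auto
      then show ?thesis by (rule ab)
    qed
    from arg_cong[OF summation_by_parts[OF h this, where n = n and \<omega> = \<omega>], where f = cmod]
    have "cmod (1 - \<omega>) ^ n * cmod (\<Sum>k<K. of_real (chi (real k * h)) * \<omega> ^ k)
        = cmod (\<Sum>k<K + n. of_real ((back_diff h ^^ n) chi (real k * h)) * \<omega> ^ k)"
      by (simp only: norm_mult norm_power)
    also have "\<dots> \<le> (\<Sum>k<K + n. h ^ n * D)"
    proof (intro order_trans[OF norm_sum] sum_mono)
      fix k
      have "\<bar>(back_diff h ^^ n) (F 0) (real k * h)\<bar> \<le> h ^ n * D"
        by (rule abs_back_diff_funpow_le[OF less_imp_le[OF h] F(2) D(2)])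
      then show "cmod (of_real ((back_diff h ^^ n) chi (real k * h)) * \<omega> ^ k) \<le> h ^ n * D"
        by (simp add: norm_mult norm_power \<omega> F(1))
    qed
    finally have "cmod (1 - \<omega>) ^ n * cmod (\<Sum>k<K. of_real (chi (real k * h)) * \<omega> ^ k)
        \<le> real (K + n) * (h ^ n * D)" by simp
    then have "real K ^ n * (cmod (1 - \<omega>) ^ n * cmod (\<Sum>k<K. of_real (chi (real k * h)) * \<omega> ^ k))
        \<le> real K ^ n * (real (K + n) * (h ^ n * D))"
      by (intro mult_left_mono) auto
    also have "\<dots> = (real K * h) ^ n * (real (K + n) * D)"
      by (simp add: power_mult_distrib)
    also have "\<dots> = real (K + n) * D"
      by (simp add: Kh)
    also have "\<dots> \<le> (1 + real n) * real K * D"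
    proof (intro mult_right_mono)
      have "real n * 1 \<le> real n * real K" using K by (intro mult_left_mono) auto
      then show "real (K + n) \<le> (1 + real n) * real K" by (simp add: algebra_simps)
    qed (use D in auto)
    finally show ?thesis
      by (simp add: h_def power_mult_distrib algebra_simps)
  qed
  then show ?thesis
    using that[of "(1 + real n) * D"] D by auto
qed

section \<open>Distance of a point of the unit circle from 1\<close>

lemma quarter_le_sin:
  assumes "0 \<le> x" "x \<le> pi / 2"
  shows "x / 4 \<le> sin (x::real)"
\<comment> \<open>Up to \<open>pi / 3\<close> the derivative \<open>cos y - 1 / 4\<close> is
  nonnegative; beyond it the sine is at least 1/2 while \<open>x\<close> is at most 2.\<close>
proof (cases "x \<le> pi / 3")
  case True
  have "sin 0 - 0 / 4 \<le> sin x - x / 4"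
  proof (rule DERIV_nonneg_imp_nondecreasing[OF assms(1)])
    fix y assume y: "0 \<le> y" "y \<le> x"
    have "cos (pi / 3) \<le> cos y"
      using y True by (intro cos_monotone_0_pi_le) auto
    then have "0 \<le> cos y - 1 / 4"
      by (simp add: cos_60)
    moreover have "((\<lambda>x. sin x - x / 4) has_real_derivative cos y - 1 / 4) (at y)"
      by (auto intro!: derivative_eq_intros)
    ultimately show "\<exists>d. ((\<lambda>x. sin x - x / 4) has_real_derivative d) (at y) \<and> 0 \<le> d"
      by blast
  qed
  then show ?thesis by simp
next
  case False
  have "sin (pi / 6) \<le> sin x"
    using False assms by (intro sin_monotone_2pi_le) auto
  then have "1 / 2 \<le> sin x"
    by (simp add: sin_30)
  moreover have "x \<le> 2"
    using assms pi_less_4 by simp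
  ultimately show ?thesis by simp
qed

text \<open>The right-hand side is twice the modulus of \<open>sin (pi * \<theta>)\<close>, which
  vanishes at 1 and -1 as well as at 0. The margin \<open>c\<close> excludes these two points; it
  will come from the support of \<open>chi\<close> being compact in the open unit interval.\<close>

lemma cmod_one_minus_cis_ge:
  assumes "c > 0" and \<theta>: "\<bar>\<theta>\<bar> \<le> 1 - c"
  shows "c * \<bar>\<theta>\<bar> \<le> cmod (1 - cis (2 * pi * \<theta>))"
proof -
  define y where "y = \<bar>\<theta>\<bar>"
  have y: "0 \<le> y" "y \<le> 1 - c" using \<theta> by (auto simp: y_def)
  have "c * y / 2 \<le> sin (pi * y)"
  proof (cases "y \<le> 1 / 2")
    case True
    have "c * y \<le> y" using y assms mult_right_mono[of c 1 y] by simp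
    moreover have "2 * y \<le> pi * y" using y pi_ge_two by (intro mult_right_mono) auto
    moreover have "pi * y / 4 \<le> sin (pi * y)"
      by (rule quarter_le_sin) (use True y mult_left_mono[of y "1/2" pi] in auto)
    ultimately show ?thesis by simp
  next
    case False
    \<comment> \<open>Near \<open>y = 1\<close> the sine is controlled by the reflected distance
      \<open>1 - y\<close>, which is at least \<open>c\<close>.\<close>
    have "c * y \<le> c" using y assms mult_left_mono[of y 1 c] by simp
    moreover have "2 * (1 - y) \<le> pi * (1 - y)" using y assms pi_ge_two by (intro mult_right_mono) auto
    moreover have "pi * (1 - y) / 4 \<le> sin (pi * (1 - y))"
      by (rule quarter_le_sin) (use False y assms mult_left_mono[of "1 - y" "1/2" pi] in auto)
    moreover have "sin (pi * (1 - y)) = sin (pi * y)"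
      by (simp add: right_diff_distrib sin_diff)
    ultimately show ?thesis using y by simp
  qed
  also have "sin (pi * y) \<le> \<bar>sin (pi * \<theta>)\<bar>"
    by (cases "\<theta> \<ge> 0") (auto simp: y_def)
  finally have "c * y \<le> 2 * \<bar>sin (pi * \<theta>)\<bar>" by simp
  also have "\<dots> = cmod (1 - cis (2 * pi * \<theta>))"
    using dist_exp_i_1[of "2 * pi * \<theta>"] by (simp add: cis_conv_exp norm_minus_commute)
  finally show ?thesis by (simp add: y_def)
qed

section \<open>Matrix entries of the baker's map\<close>

lemma mult_chi_mult_index:
  assumes "E \<in> carrier_mat n K" "i < n" "k < K"
  shows "(E * chi_mult chi K) $$ (i,k) = E $$ (i,k) * of_real (chi (real k / real K))"
  using assms by (auto simp: chi_mult_def scalar_prod_def if_distrib cong: if_cong)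

lemma mult_Proj_index:
  assumes "E \<in> carrier_mat n K" "i < n" "j < N"
  shows "(E * Proj K N a) $$ (i,j) = (if a * K \<le> j \<and> j < a * K + K then E $$ (i, j - a * K) else 0)"
proof -
  have "(E * Proj K N a) $$ (i,j) = (\<Sum>k = 0..<K. if j = k + a * K then E $$ (i,k) else 0)"
    using assms by (auto simp: Proj_def scalar_prod_def intro!: sum.cong)
  also have "\<dots> = (\<Sum>k = 0..<K. if k = j - a * K then (if a * K \<le> j then E $$ (i,k) else 0) else 0)"
    by (intro sum.cong) auto
  also have "\<dots> = (if a * K \<le> j \<and> j < a * K + K then E $$ (i, j - a * K) else 0)"
    by auto
  finally show ?thesis .
qed

lemma mat_adjoint_index:
  assumes "i < dim_col A" "j < dim_row A"
  shows "mat_adjoint A $$ (i,j) = conjugate (A $$ (j,i))"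
  using assms by (simp add: mat_adjoint_def mat_of_rows_index)

lemma mat_adjoint_carrier:
  "A \<in> carrier_mat m n \<Longrightarrow> mat_adjoint A \<in> carrier_mat n m"
  by (auto simp: mat_adjoint_def)

lemma mult_adjoint_Proj_index:
  assumes "E \<in> carrier_mat n N" "i < n" "k < K" "k + a * K < N"
  shows "(E * mat_adjoint (Proj K N a)) $$ (i,k) = E $$ (i, k + a * K)"
proof -
  have "(E * mat_adjoint (Proj K N a)) $$ (i,k) = (\<Sum>j = 0..<N. if j = k + a * K then E $$ (i,j) else 0)"
  proof -
    have "mat_adjoint (Proj K N a) \<in> carrier_mat N K"
      by (rule mat_adjoint_carrier) (simp add: Proj_def)
    moreover have "mat_adjoint (Proj K N a) $$ (j,k) = (if j = k + a * K then 1 else 0)" if "j < N" for j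
      using that assms by (simp add: mat_adjoint_index Proj_def)
    ultimately have "(E * mat_adjoint (Proj K N a)) $$ (i,k)
        = (\<Sum>j = 0..<N. E $$ (i,j) * (if j = k + a * K then 1 else 0))"
      using assms by (auto simp: scalar_prod_def)
    then show ?thesis by (simp add: if_distrib cong: if_cong)
  qed
  then show ?thesis
    using assms by simp
qed

lemma mult_mat_index_sum:
  assumes "E \<in> carrier_mat n K" "F \<in> carrier_mat K m" "i < n" "j < m"
  shows "(E * F) $$ (i,j) = (\<Sum>k=0..<K. E $$ (i,k) * F $$ (k,j))"
  using assms by (auto simp: scalar_prod_def)

lemma block_index_less:
  assumes "k < K" "a < M"
  shows "k + a * K < K * (M::nat)"
proof -
  have "k + a * K < (a + 1) * K" using assms by simp
  also have "\<dots> \<le> M * K" using assms by (intro mult_right_mono) auto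
  finally show ?thesis by (simp add: mult.commute)
qed

text \<open>The column index is split into block \<open>a\<close> and offset \<open>l\<close>. The
  projection on the right keeps only the columns of block \<open>b\<close>, and its adjoint selects
  the frequencies \<open>k + b * K\<close>, so a single sum remains.\<close>

lemma baker_term_index:
  assumes i: "i < K * M" and l: "l < K" and a: "a < M" and b: "b < M"
  shows "baker_term M chi K b $$ (i, l + a * K) = (if a = b then
    (\<Sum>k<K. cnj (DFT (K * M) $$ (k + a * K, i)) * of_real (chi (real k / real K)) * DFT K $$ (k,l))
      * of_real (chi (real l / real K)) else 0)"
proof -
  define E1 where "E1 = mat_adjoint (DFT (K * M)) * mat_adjoint (Proj K (K * M) b)"
  define E2 where "E2 = E1 * chi_mult chi K * DFT K"
  have D: "DFT n \<in> carrier_mat n n" for n by (simp add: DFT_def)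
  have X: "chi_mult chi K \<in> carrier_mat K K" by (simp add: chi_mult_def)
  have P: "Proj K (K * M) b \<in> carrier_mat K (K * M)" by (simp add: Proj_def)
  have E1: "E1 \<in> carrier_mat (K * M) K"
    unfolding E1_def using mat_adjoint_carrier[OF D[of "K * M"]] mat_adjoint_carrier[OF P]
    by (rule mult_carrier_mat)
  have E1X: "E1 * chi_mult chi K \<in> carrier_mat (K * M) K"
    by (rule mult_carrier_mat[OF E1 X])
  have E2: "E2 \<in> carrier_mat (K * M) K"
    unfolding E2_def by (rule mult_carrier_mat[OF E1X D])
  have E2X: "E2 * chi_mult chi K \<in> carrier_mat (K * M) K"
    by (rule mult_carrier_mat[OF E2 X])
  have E1_index: "E1 $$ (i,k) = cnj (DFT (K * M) $$ (k + b * K, i))" if "k < K" for k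
    unfolding E1_def
    by (subst mult_adjoint_Proj_index[OF mat_adjoint_carrier[OF D] i that block_index_less[OF that b]],
        subst mat_adjoint_index) (use block_index_less[OF that b] i in \<open>auto simp: DFT_def\<close>)
  have E2_index: "E2 $$ (i,l') = (\<Sum>k<K. cnj (DFT (K * M) $$ (k + b * K, i))
      * of_real (chi (real k / real K)) * DFT K $$ (k,l'))" if "l' < K" for l'
  proof -
    have "E2 $$ (i,l') = (\<Sum>k=0..<K. (E1 * chi_mult chi K) $$ (i,k) * DFT K $$ (k,l'))"
      unfolding E2_def by (rule mult_mat_index_sum[OF E1X D i that])
    also have "\<dots> = (\<Sum>k<K. cnj (DFT (K * M) $$ (k + b * K, i))
      * of_real (chi (real k / real K)) * DFT K $$ (k,l'))"
      unfolding atLeast0LessThan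
      by (intro sum.cong refl) (simp add: mult_chi_mult_index[OF E1 i] E1_index del: index_mult_mat)
    finally show ?thesis .
  qed
  have between: "b * K \<le> l + a * K \<and> l + a * K < b * K + K \<longleftrightarrow> a = b"
  proof
    assume "b * K \<le> l + a * K \<and> l + a * K < b * K + K"
    then have "(l + a * K) div K = b"
      by (intro div_nat_eqI) (auto simp: algebra_simps)
    then show "a = b" using l by simp
  qed (use l in auto)
  have "baker_term M chi K b = E2 * chi_mult chi K * Proj K (K * M) b"
    by (simp add: baker_term_def E2_def E1_def)
  then have "baker_term M chi K b $$ (i, l + a * K)
      = (if a = b then (E2 * chi_mult chi K) $$ (i, l) else 0)"
    by (simp add: mult_Proj_index[OF E2X i block_index_less[OF l a]] between del: index_mult_mat)
  then show ?thesis
    by (simp add: mult_chi_mult_index[OF E2 i l] E2_index[OF l] del: index_mult_mat)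
qed

text \<open>The two Fourier phases combine into a factor of modulus one independent of
  \<open>k\<close>, times the \<open>k\<close>-th power of one unit number. What is left depends on
  the row only through \<open>i - M * l\<close>.\<close>

lemma cmod_baker_index:
  assumes K: "K > 0" and M: "M > 0" and A: "\<A> \<subseteq> {0..<M}"
    and i: "i < K * M" and l: "l < K" and a: "a < M" and chi: "\<And>x. 0 \<le> chi x"
  shows "cmod (baker M \<A> chi K $$ (i, l + a * K)) = (if a \<in> \<A> then
    chi (real l / real K) / (sqrt M * real K) * cmod (\<Sum>k<K. of_real (chi (real k / real K))
      * cis (2 * pi * ((real i - real M * real l) / real (K * M))) ^ k) else 0)"
proof -
  have "finite \<A>" using A finite_subset by blast
  have "baker M \<A> chi K $$ (i, l + a * K) = (\<Sum>b\<in>\<A>. baker_term M chi K b $$ (i, l + a * K))"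
    using i block_index_less[OF l a] by (simp add: baker_def)
  also have "\<dots> = (\<Sum>b\<in>\<A>. if a = b then
    (\<Sum>k<K. cnj (DFT (K * M) $$ (k + a * K, i)) * of_real (chi (real k / real K)) * DFT K $$ (k,l))
      * of_real (chi (real l / real K)) else 0)"
    using A by (intro sum.cong refl baker_term_index[OF i l a]) auto
  also have "\<dots> = (if a \<in> \<A> then (\<Sum>k<K. cnj (DFT (K * M) $$ (k + a * K, i))
      * of_real (chi (real k / real K)) * DFT K $$ (k,l)) * of_real (chi (real l / real K)) else 0)"
    using \<open>finite \<A>\<close> by simp
  finally have entry: "baker M \<A> chi K $$ (i, l + a * K) = \<dots>" .
  define \<omega> where "\<omega> = cis (2 * pi * ((real i - real M * real l) / real (K * M)))"
  have "cnj (DFT (K * M) $$ (k + a * K, i)) * of_real (chi (real k / real K)) * DFT K $$ (k,l)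
      = cis (2 * pi * real a * real i / real M) / (of_real (sqrt (K * M)) * of_real (sqrt K))
        * (of_real (chi (real k / real K)) * \<omega> ^ k)" if k: "k < K" for k
  proof -
    have D1: "DFT (K * M) $$ (k + a * K, i)
        = cis (- (2 * pi * real (k + a * K) * real i / real (K * M))) / of_real (sqrt (K * M))"
      using block_index_less[OF k a] i by (simp add: DFT_def cis_conv_exp algebra_simps)
    have D2: "DFT K $$ (k,l) = cis (- (2 * pi * real k * real l / real K)) / of_real (sqrt K)"
      using k l by (simp add: DFT_def cis_conv_exp algebra_simps)
    have "cis (2 * pi * real (k + a * K) * real i / real (K * M)) * cis (- (2 * pi * real k * real l / real K))
        = cis (2 * pi * real a * real i / real M) * \<omega> ^ k"
      unfolding \<omega>_def Complex.DeMoivre cis_mult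
      using K M by (intro arg_cong[of _ _ cis]) (simp add: field_simps)
    then show ?thesis
      unfolding D1 D2 by (simp add: cis_cnj ac_simps)
  qed
  then have "(\<Sum>k<K. cnj (DFT (K * M) $$ (k + a * K, i)) * of_real (chi (real k / real K)) * DFT K $$ (k,l))
      = cis (2 * pi * real a * real i / real M) / (of_real (sqrt (K * M)) * of_real (sqrt K))
        * (\<Sum>k<K. of_real (chi (real k / real K)) * \<omega> ^ k)"
    by (simp add: sum_distrib_left)
  moreover have "sqrt (K * M) * sqrt K = sqrt M * real K"
    by (simp add: real_sqrt_mult)
  ultimately show ?thesis
    using chi[of "real l / real K"] unfolding entry \<omega>_def[symmetric]
    by (simp add: norm_mult norm_divide flip: of_real_mult)
qed

text \<open>With \<open>u\<close> the distance from \<open>i\<close> to \<open>M * l\<close>, the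
  angle has size \<open>u / (K * M)\<close>, so \<open>K * cmod (1 - \<omega>)\<close> is at least
  \<open>c * u / M\<close>. The factors \<open>K\<close> cancel, which makes the decay uniform in
  \<open>K\<close>.\<close>

lemma baker_kernel_decay:
  assumes M: "M > 0" and A: "\<A> \<subseteq> {0..<M}" and chi: "cutoff01 chi"
  obtains C where "C \<ge> 0" "\<And>K i l a. K > 0 \<Longrightarrow> i < K * M \<Longrightarrow> l < K \<Longrightarrow> a < M \<Longrightarrow>
    cmod (baker M \<A> chi K $$ (i, l + a * K)) * (1 + \<bar>real i - real M * real l\<bar>) ^ n \<le> C"
proof -
  obtain \<alpha> \<beta> where supp: "0 < \<alpha>" "\<beta> < 1" "\<And>x. x \<notin> {\<alpha>..\<beta>} \<Longrightarrow> chi x = 0"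
    and range: "\<And>x. 0 \<le> chi x" "\<And>x. chi x \<le> 1"
    using chi by (auto simp: cutoff01_def)
  \<comment> \<open>For a nonzero entry the angle is a difference of a number in
    \<open>{0..1}\<close> and one in \<open>{\<alpha>..\<beta>}\<close>, so it keeps distance
    \<open>c\<close> from 1 and -1.\<close>
  define c where "c = min \<alpha> (1 - \<beta>)"
  have c: "c > 0" using supp by (simp add: c_def)
  \<comment> \<open>Order 0 bounds the entry itself and order \<open>n\<close> its product with
    \<open>u ^ n\<close>; together they control \<open>(1 + u) ^ n\<close>.\<close>
  obtain C0 where C0: "C0 \<ge> 0" "\<And>K \<omega>. K \<ge> 1 \<Longrightarrow> cmod \<omega> = 1 \<Longrightarrow>
    (real K * cmod (1 - \<omega>)) ^ 0 * cmod (\<Sum>k<K. of_real (chi (real k / real K)) * \<omega> ^ k) \<le> C0 * real K"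
    by (rule cutoff01_exponential_sum_bound[OF chi, of 0]) blast
  obtain C1 where C1: "C1 \<ge> 0" "\<And>K \<omega>. K \<ge> 1 \<Longrightarrow> cmod \<omega> = 1 \<Longrightarrow>
    (real K * cmod (1 - \<omega>)) ^ n * cmod (\<Sum>k<K. of_real (chi (real k / real K)) * \<omega> ^ k) \<le> C1 * real K"
    by (rule cutoff01_exponential_sum_bound[OF chi, of n]) blast
  let ?C = "2 ^ n * (C0 + C1 * (real M / c) ^ n)"
  have "cmod (baker M \<A> chi K $$ (i, l + a * K)) * (1 + \<bar>real i - real M * real l\<bar>) ^ n \<le> ?C"
    if K: "K > 0" and i: "i < K * M" and l: "l < K" and a: "a < M" for K i l a
  proof (cases "a \<in> \<A> \<and> real l / real K \<in> {\<alpha>..\<beta>}")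
    case False
    then have "cmod (baker M \<A> chi K $$ (i, l + a * K)) = 0"
      using cmod_baker_index[OF K M A i l a range(1)] supp(3) by auto
    then show ?thesis
      using C0 C1 c by simp
  next
    case True
    define \<theta> where "\<theta> = (real i - real M * real l) / real (K * M)"
    define \<omega> where "\<omega> = cis (2 * pi * \<theta>)"
    define s where "s = cmod (\<Sum>k<K. of_real (chi (real k / real K)) * \<omega> ^ k) / real K"
    define u where "u = \<bar>real i - real M * real l\<bar>"
    have s0: "s \<ge> 0" and u0: "u \<ge> 0" by (auto simp: s_def u_def)
    have "cmod (baker M \<A> chi K $$ (i, l + a * K)) = chi (real l / real K) / sqrt M * s"
      using cmod_baker_index[OF K M A i l a range(1)] True by (simp add: s_def \<omega>_def \<theta>_def)
    also have "\<dots> \<le> 1 * s"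
    proof (rule mult_right_mono[OF _ s0])
      have "1 \<le> sqrt (real M)" using M by simp
      then have "chi (real l / real K) \<le> sqrt M"
        using range(2)[of "real l / real K"] by linarith
      then show "chi (real l / real K) / sqrt M \<le> 1"
        using M by (simp add: divide_le_eq)
    qed
    finally have le_s: "cmod (baker M \<A> chi K $$ (i, l + a * K)) \<le> s" by simp
    have "\<theta> = real i / real (K * M) - real l / real K"
      using K M by (simp add: \<theta>_def field_simps)
    moreover have "0 \<le> real i / real (K * M)" "real i / real (K * M) \<le> 1"
      using i by (auto simp: divide_le_eq simp flip: of_nat_mult)
    moreover have "\<alpha> \<le> real l / real K" "real l / real K \<le> \<beta>"
      using True by auto
    ultimately have "\<bar>\<theta>\<bar> \<le> 1 - c"
      unfolding c_def by linarith
    from cmod_one_minus_cis_ge[OF c this] have "c * \<bar>\<theta>\<bar> \<le> cmod (1 - \<omega>)"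
      by (simp add: \<omega>_def)
    moreover have "\<bar>\<theta>\<bar> = u / real (K * M)"
      by (simp add: \<theta>_def u_def)
    ultimately have "c * u / real M \<le> real K * cmod (1 - \<omega>)"
      using K M by (simp add: field_simps)
    then have "(c * u / real M) ^ n * s \<le> (real K * cmod (1 - \<omega>)) ^ n * s"
      using c u0 s0 by (intro mult_right_mono power_mono) auto
    also have "\<dots> \<le> C1"
      using C1(2)[of K \<omega>] K by (simp add: s_def divide_le_eq \<omega>_def)
    finally have scaled: "(real M / c) ^ n * ((c * u / real M) ^ n * s) \<le> (real M / c) ^ n * C1"
      using c by (intro mult_left_mono) auto
    have "(real M / c) ^ n * ((c * u / real M) ^ n * s) = u ^ n * s"
      using c M by (simp add: power_divide power_mult_distrib)
    with scaled have un: "s * u ^ n \<le> C1 * (real M / c) ^ n"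
      by (simp only: mult.commute)
    have sC0: "s \<le> C0"
      using C0(2)[of K \<omega>] K by (simp add: s_def divide_le_eq \<omega>_def)
    have "(1 + u) ^ n \<le> 2 ^ n * (1 + u ^ n)"
    proof (cases "u \<le> 1")
      case True
      then have "(1 + u) ^ n \<le> 2 ^ n * 1" using u0 by (auto intro: power_mono)
      also have "\<dots> \<le> 2 ^ n * (1 + u ^ n)" using u0 by (intro mult_left_mono) auto
      finally show ?thesis .
    next
      case False
      then have "(1 + u) ^ n \<le> (2 * u) ^ n" by (intro power_mono) auto
      also have "\<dots> \<le> 2 ^ n * (1 + u ^ n)" by (simp add: power_mult_distrib)
      finally show ?thesis .
    qed
    then have "s * (1 + u) ^ n \<le> s * (2 ^ n * (1 + u ^ n))"
      by (rule mult_left_mono[OF _ s0])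
    also have "\<dots> = 2 ^ n * (s + s * u ^ n)"
      by (simp add: algebra_simps)
    also have "\<dots> \<le> ?C"
      by (intro mult_left_mono add_mono sC0 un) auto
    finally have "s * (1 + u) ^ n \<le> ?C" .
    moreover have "cmod (baker M \<A> chi K $$ (i, l + a * K)) * (1 + u) ^ n \<le> s * (1 + u) ^ n"
      using le_s u0 by (intro mult_right_mono) auto
    ultimately show ?thesis unfolding u_def by linarith
  qed
  moreover have "?C \<ge> 0" using C0 C1 c by simp
  ultimately show ?thesis using that[of ?C] by blast
qed

subsection \<open>The Cantor set\<close>

lemma card_nat_near_le:
  assumes "E \<ge> 0"
  shows "finite {j::nat. \<bar>real j - x\<bar> \<le> E}" "real (card {j::nat. \<bar>real j - x\<bar> \<le> E}) \<le> 2 * E + 1"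
proof -
  have sub: "{j::nat. \<bar>real j - x\<bar> \<le> E} \<subseteq> nat ` {\<lceil>x - E\<rceil>..\<lfloor>x + E\<rfloor>}"
  proof
    fix j :: nat assume "j \<in> {j. \<bar>real j - x\<bar> \<le> E}"
    then have "int j \<in> {\<lceil>x - E\<rceil>..\<lfloor>x + E\<rfloor>}"
      by (auto simp: ceiling_le_iff le_floor_iff)
    then show "j \<in> nat ` {\<lceil>x - E\<rceil>..\<lfloor>x + E\<rfloor>}"
      by (metis image_eqI nat_int)
  qed
  then show "finite {j::nat. \<bar>real j - x\<bar> \<le> E}"
    by (rule finite_subset) auto
  have "card {j::nat. \<bar>real j - x\<bar> \<le> E} \<le> card {\<lceil>x - E\<rceil>..\<lfloor>x + E\<rfloor>}"
    using sub by (rule surj_card_le[rotated]) auto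
  also have "real \<dots> \<le> 2 * E + 1"
    using assms by simp linarith
  finally show "real (card {j::nat. \<bar>real j - x\<bar> \<le> E}) \<le> 2 * E + 1"
    by simp
qed

text \<open>Starting from the fixed point of one branch makes every point an image under some branch, so
  that the set is covered by \<^term>\<open>card \<A> ^ k\<close> intervals of length \<^term>\<open>1 / real M ^ k\<close>. It need not
  be closed, since only the distance to it matters.\<close>

inductive_set cantor :: "nat \<Rightarrow> nat set \<Rightarrow> nat \<Rightarrow> real set" for M \<A> a\<^sub>0 where
  fixed: "real a\<^sub>0 / (real M - 1) \<in> cantor M \<A> a\<^sub>0"
| step: "x \<in> cantor M \<A> a\<^sub>0 \<Longrightarrow> a \<in> \<A> \<Longrightarrow> (x + real a) / real M \<in> cantor M \<A> a\<^sub>0"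

lemma cantor_nonempty: "cantor M \<A> a\<^sub>0 \<noteq> {}"
  using cantor.fixed by blast

context
  fixes M :: nat and \<A> :: "nat set" and a\<^sub>0 :: nat
  assumes M: "M \<ge> 2" and A: "\<A> \<subseteq> {0..<M}" and a\<^sub>0: "a\<^sub>0 \<in> \<A>"
begin

lemma cantor_unit_interval: "x \<in> cantor M \<A> a\<^sub>0 \<Longrightarrow> 0 \<le> x \<and> x \<le> 1"
proof (induction rule: cantor.induct)
  case fixed
  have "a\<^sub>0 < M" using A a\<^sub>0 by auto
  then show ?case using M by (auto simp: divide_le_eq)
next
  case (step x a)
  then have "a < M" using A by auto
  then have "real a \<le> real M - 1" by linarith
  then show ?case using step M by (auto simp: divide_le_eq)
qed

lemma cantor_preimage:
  assumes "x \<in> cantor M \<A> a\<^sub>0"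
  obtains y a where "y \<in> cantor M \<A> a\<^sub>0" "a \<in> \<A>" "x = (y + real a) / real M"
  using assms
proof cases
  case fixed
  moreover have "real a\<^sub>0 / (real M - 1) = (real a\<^sub>0 / (real M - 1) + real a\<^sub>0) / real M"
    using M by (simp add: field_simps)
  ultimately show ?thesis
    using that[OF cantor.fixed a\<^sub>0] by simp
qed (use that in blast)

text \<open>The branches shrink the intervals of a cover by \<open>M\<close> and multiply their
  number by at most \<open>card \<A>\<close>. \<open>F\<close> holds the left endpoints.\<close>

lemma cantor_cover:
  "\<exists>F. finite F \<and> card F \<le> card \<A> ^ k \<and> (\<forall>x\<in>cantor M \<A> a\<^sub>0. \<exists>c\<in>F. c \<le> x \<and> x \<le> c + 1 / real M ^ k)"
proof (induction k)
  case 0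
  show ?case
    by (rule exI[of _ "{0}"]) (use cantor_unit_interval in auto)
next
  case (Suc k)
  then obtain F where F: "finite F" "card F \<le> card \<A> ^ k"
    "\<And>x. x \<in> cantor M \<A> a\<^sub>0 \<Longrightarrow> \<exists>c\<in>F. c \<le> x \<and> x \<le> c + 1 / real M ^ k"
    by blast
  let ?F = "(\<lambda>(a, c). (c + real a) / real M) ` (\<A> \<times> F)"
  have "finite \<A>" using A finite_subset by blast
  have "card ?F \<le> card (\<A> \<times> F)"
    using \<open>finite \<A>\<close> F by (intro card_image_le) auto
  also have "\<dots> \<le> card \<A> * card \<A> ^ k"
    unfolding card_cartesian_product using F by (intro mult_left_mono) auto
  finally have "card ?F \<le> card \<A> ^ Suc k" by simp
  moreover have "\<exists>c\<in>?F. c \<le> x \<and> x \<le> c + 1 / real M ^ Suc k" if "x \<in> cantor M \<A> a\<^sub>0" for x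
  proof -
    obtain y a where ya: "y \<in> cantor M \<A> a\<^sub>0" "a \<in> \<A>" "x = (y + real a) / real M"
      using cantor_preimage[OF \<open>x \<in> _\<close>] .
    obtain c where c: "c \<in> F" "c \<le> y" "y \<le> c + 1 / real M ^ k"
      using F(3)[OF ya(1)] by blast
    have "(c + real a) / real M \<le> x"
      unfolding ya(3) using c by (intro divide_right_mono) auto
    moreover have "x \<le> (c + 1 / real M ^ k + real a) / real M"
      unfolding ya(3) using c by (intro divide_right_mono) auto
    moreover have "(c + 1 / real M ^ k + real a) / real M = (c + real a) / real M + 1 / real M ^ Suc k"
      using M by (simp add: field_simps)
    ultimately show ?thesis
      using c(1) ya(2) by (intro bexI[of _ "(c + real a) / real M"]) auto
  qed
  ultimately show ?case
    using \<open>finite \<A>\<close> F(1) by (intro exI[of _ ?F]) auto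
qed

text \<open>For \<open>y\<close> in the set, \<open>(y + real a) / real M\<close> is also in the
  set, and the expanding map of branch \<open>a\<close> sends it to \<open>y\<close>, scaling its
  distance from \<open>x\<close> by exactly \<open>M\<close>. Equality can fail because another
  piece may be nearer to \<open>x\<close>.\<close>

lemma infdist_cantor_expanding:
  assumes "a \<in> \<A>"
  shows "real M * infdist x (cantor M \<A> a\<^sub>0) \<le> infdist (real M * x - real a) (cantor M \<A> a\<^sub>0)"
proof -
  have "real M * infdist x (cantor M \<A> a\<^sub>0) \<le> dist (real M * x - real a) y"
    if y: "y \<in> cantor M \<A> a\<^sub>0" for y
  proof -
    have "infdist x (cantor M \<A> a\<^sub>0) \<le> \<bar>x - (y + real a) / real M\<bar>"
      using infdist_le[OF cantor.step[OF y assms], of x] by (simp add: dist_real_def)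
    then have "real M * infdist x (cantor M \<A> a\<^sub>0) \<le> \<bar>real M\<bar> * \<bar>x - (y + real a) / real M\<bar>"
      by (simp add: mult_left_mono)
    also have "\<dots> = \<bar>real M * x - real a - y\<bar>"
      using M by (simp add: abs_mult[symmetric] field_simps)
    finally show ?thesis by (simp add: dist_real_def)
  qed
  then show ?thesis
    using cantor_nonempty by (subst infdist_notempty) (auto intro!: cINF_greatest)
qed

text \<open>Choosing \<open>k\<close> with \<open>M ^ k\<close> comparable to \<open>N\<close>, the
  level \<open>k\<close> intervals have length at most \<open>M\<close> after scaling by
  \<open>N\<close>, so each accounts for boundedly many indices. Their number is at most
  \<open>card \<A> ^ k\<close>, which is \<open>M ^ k\<close> to the power
  \<open>?\<delta>\<close>.\<close>

lemma card_near_cantor_le: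
  assumes D: "D \<ge> 0" and N: "N \<ge> 1"
  shows "real (card {j. j < N \<and> real N * infdist (real j / real N) (cantor M \<A> a\<^sub>0) \<le> D})
    \<le> (2 * (D + 1 + real M) + 1) * real N powr (ln (real (card \<A>)) / ln (real M))"
proof -
  let ?X = "cantor M \<A> a\<^sub>0" and ?E = "D + 1 + real M" and ?\<delta> = "ln (real (card \<A>)) / ln (real M)"
  obtain k where k: "M ^ k \<le> N" "N < M ^ (k + 1)"
    using ex_power_ivl1[OF M N] by blast
  obtain F where F: "finite F" "card F \<le> card \<A> ^ k"
    "\<And>x. x \<in> ?X \<Longrightarrow> \<exists>c\<in>F. c \<le> x \<and> x \<le> c + 1 / real M ^ k"
    using cantor_cover[of k] by blast
  have "real N < real (M ^ (k + 1))"
    using k by linarith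
  then have NM: "real N / real M ^ k \<le> real M"
    using M by (simp add: divide_le_eq)
  have sub: "{j. j < N \<and> real N * infdist (real j / real N) ?X \<le> D}
      \<subseteq> (\<Union>c\<in>F. {j. \<bar>real j - real N * c\<bar> \<le> ?E})"
  proof
    fix j assume "j \<in> {j. j < N \<and> real N * infdist (real j / real N) ?X \<le> D}"
    \<comment> \<open>The slack of 1 makes the inequality strict, so that some point of the set
      satisfies it even if the infimum is not attained.\<close>
    then have "real N * infdist (real j / real N) ?X < D + 1" by simp
    then have "infdist (real j / real N) ?X < (D + 1) / real N"
      using N by (simp add: field_simps)
    then obtain y where y: "y \<in> ?X" "dist (real j / real N) y < (D + 1) / real N"
      using cINF_greatest[OF cantor_nonempty, of M \<A> a\<^sub>0 "(D + 1) / real N" "dist (real j / real N)"]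
      unfolding infdist_notempty[OF cantor_nonempty] by force
    obtain c where c: "c \<in> F" "c \<le> y" "y \<le> c + 1 / real M ^ k"
      using F(3)[OF y(1)] by blast
    have "\<bar>real j - real N * y\<bar> = real N * dist (real j / real N) y"
      using N by (simp add: dist_real_def abs_mult_pos' right_diff_distrib)
    also have "\<dots> \<le> D + 1"
      using y(2) N by (simp add: field_simps)
    finally have "\<bar>real j - real N * y\<bar> \<le> D + 1" .
    moreover have "real N * c \<le> real N * y" "real N * y \<le> real N * (c + 1 / real M ^ k)"
      using c by (auto intro: mult_left_mono)
    ultimately have "\<bar>real j - real N * c\<bar> \<le> ?E"
      using NM by (simp add: algebra_simps abs_le_iff)
    then show "j \<in> (\<Union>c\<in>F. {j. \<bar>real j - real N * c\<bar> \<le> ?E})"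
      using c(1) by blast
  qed
  have E: "?E \<ge> 0" using D by simp
  have "card {j. j < N \<and> real N * infdist (real j / real N) ?X \<le> D}
      \<le> card (\<Union>c\<in>F. {j. \<bar>real j - real N * c\<bar> \<le> ?E})"
    using sub F(1) card_nat_near_le(1)[OF E] by (intro card_mono) auto
  also have "\<dots> \<le> (\<Sum>c\<in>F. card {j::nat. \<bar>real j - real N * c\<bar> \<le> ?E})"
    by (rule card_UN_le[OF F(1)])
  also have "real \<dots> \<le> (\<Sum>c\<in>F. 2 * ?E + 1)"
    unfolding of_nat_sum by (intro sum_mono card_nat_near_le(2)[OF E])
  also have "\<dots> = (2 * ?E + 1) * real (card F)"
    by simp
  also have "\<dots> \<le> (2 * ?E + 1) * real N powr ?\<delta>"
  proof (rule mult_left_mono)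
    have "finite \<A>" using A finite_subset by blast
    then have cA: "card \<A> > 0" using a\<^sub>0 card_gt_0_iff by blast
    have "real (card F) \<le> real (card \<A>) ^ k"
      using F(2) by (metis of_nat_le_iff of_nat_power)
    also have "real (card \<A>) = real M powr ?\<delta>"
      using M cA by (simp add: powr_def)
    also have "(real M powr ?\<delta>) ^ k = real (M ^ k) powr ?\<delta>"
      using M by (simp add: powr_realpow[symmetric] powr_powr powr_powr_swap mult.commute)
    also have "\<dots> \<le> real N powr ?\<delta>"
      using k M cA by (intro powr_mono2) auto
    finally show "real (card F) \<le> real N powr ?\<delta>" .
  qed (use E in simp)
  finally show ?thesis by simp
qed

end

subsection \<open>The weighted norm\<close>

lemma sum_inverse_squares_le: "(\<Sum>k<n. 1 / (1 + real k)\<^sup>2) \<le> 2"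
proof -
  \<comment> \<open>The subtracted term lets the induction telescope.\<close>
  have partial: "(\<Sum>k<Suc n. 1 / (1 + real k)\<^sup>2) \<le> 2 - 1 / (1 + real n)" for n
  proof (induction n)
    case (Suc n)
    have "1 / (1 + real (Suc n))\<^sup>2 \<le> 1 / ((1 + real n) * (1 + real (Suc n)))"
      unfolding power2_eq_square by (intro divide_left_mono mult_right_mono) auto
    also have "\<dots> = 1 / (1 + real n) - 1 / (1 + real (Suc n))"
      by (simp add: field_simps)
    finally show ?case
      using Suc by simp
  qed simp
  have "(\<Sum>k<n. 1 / (1 + real k)\<^sup>2) \<le> (\<Sum>k<Suc n. 1 / (1 + real k)\<^sup>2)"
    by simp
  also note partial[of n]
  also have "2 - 1 / (1 + real n) \<le> 2"
    by simp
  finally show ?thesis .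
qed

lemma sum_inverse_squares_shift_le:
  "(\<Sum>i<n. 1 / (1 + \<bar>real i - real p\<bar>)\<^sup>2) \<le> 4"
proof -
  let ?g = "\<lambda>i. 1 / (1 + \<bar>real i - real p\<bar>)\<^sup>2"
  have "(\<Sum>i<n. ?g i) \<le> (\<Sum>i<p + n. ?g i)"
    by (intro sum_mono2) auto
  also have "\<dots> = (\<Sum>i<p. ?g i) + (\<Sum>i<n. ?g (p + i))"
    by (induction n) auto
  also have "(\<Sum>i<p. ?g i) \<le> (\<Sum>i<p. 1 / (1 + real (p - Suc i))\<^sup>2)"
    by (intro sum_mono divide_left_mono power_mono) auto
  also have "\<dots> = (\<Sum>i<p. 1 / (1 + real i)\<^sup>2)"
    by (rule sum.nat_diff_reindex)
  also have "(\<Sum>i<p. 1 / (1 + real i)\<^sup>2) + (\<Sum>i<n. ?g (p + i)) \<le> 2 + 2"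
    using sum_inverse_squares_le[of p] sum_inverse_squares_le[of n] by simp
  finally show ?thesis by simp
qed

text \<open>By convexity in \<open>u\<close> the power lies below its chord between 0 and 1. The
  small factor \<open>u\<close> then multiplies the whole power, which with \<open>u = 1 / R\<close>
  lets a large \<open>R\<close> offset a decay constant depending on \<open>n\<close>.\<close>

lemma power_one_plus_scaled_le:
  fixes x u :: real
  assumes "0 \<le> u" "u \<le> 1" "0 \<le> x"
  shows "(1 + u * x) ^ n \<le> 1 + u * (1 + x) ^ n"
proof -
  have "(1 + u * x) ^ n \<le> 1 - u + u * (1 + x) ^ n"
  proof (induction n)
    case (Suc n)
    have "(1 + u * x) ^ Suc n \<le> (1 + u * x) * (1 - u + u * (1 + x) ^ n)"
      using Suc assms by (simp add: mult_left_mono)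
    also have "\<dots> = 1 - u + u * (1 + x) ^ Suc n - u * x * (1 - u) * ((1 + x) ^ n - 1)"
      by (simp add: algebra_simps)
    also have "\<dots> \<le> 1 - u + u * (1 + x) ^ Suc n"
      using assms by simp
    finally show ?case .
  qed simp
  then show ?thesis using assms by linarith
qed

text \<open>With \<open>u\<close> the distance from \<open>i\<close> to \<open>M * l\<close>, the
  expansion of \<open>d\<close> shows that passing from the weight at \<open>i\<close> to the one on
  the right costs at most \<open>(1 + u / R) ^ s\<close>. The decay of the entries pays for this and
  leaves an inverse square, whose sum is at most 4. As the decay constant of order
  \<open>s + 2\<close> is at most \<open>R\<close>, the result does not depend on
  \<open>s\<close>.\<close>

lemma weighted_column_sum_le:
  fixes d :: "nat \<Rightarrow> real"
  assumes R: "R \<ge> 1" and K: "K > 0" and l: "l < K" and a: "a < M"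
    and C2: "\<And>i. i < K * M \<Longrightarrow>
      cmod (B $$ (i, l + a * K)) * (1 + \<bar>real i - real M * real l\<bar>) ^ 2 \<le> C2"
    and Cs: "\<And>i. i < K * M \<Longrightarrow>
      cmod (B $$ (i, l + a * K)) * (1 + \<bar>real i - real M * real l\<bar>) ^ (s + 2) \<le> R"
    and d0: "\<And>i. d i \<ge> 0"
    and d: "\<And>i. i < K * M \<Longrightarrow> real M * d (l + a * K) \<le> d i + \<bar>real i - real M * real l\<bar>"
  shows "(\<Sum>i<K * M. cmod (B $$ (i, l + a * K)) * (1 / (R + d i) ^ s))
    \<le> 4 * (C2 + 1) * (1 / (R + real M * d (l + a * K)) ^ s)"
proof -
  let ?j = "l + a * K"
  have M: "M > 0" using a by simp
  have C20: "C2 \<ge> 0"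
    using order_trans[OF mult_nonneg_nonneg C2[of 0]] K M by simp
  have "(\<Sum>i<K * M. cmod (B $$ (i, ?j)) * (1 / (R + d i) ^ s))
      \<le> (\<Sum>i<K * M. (C2 + 1) * (1 / (1 + \<bar>real i - real (M * l)\<bar>)\<^sup>2) * (1 / (R + real M * d ?j) ^ s))"
  proof (rule sum_mono)
    fix i assume "i \<in> {..<K * M}"
    then have i: "i < K * M" by simp
    define u where "u = \<bar>real i - real M * real l\<bar>"
    define b where "b = cmod (B $$ (i, ?j))"
    have u: "u \<ge> 0" and b: "b \<ge> 0" by (auto simp: u_def b_def)
    have Rd: "R + d i > 0" "R + real M * d ?j > 0"
      using R d0[of i] d0[of ?j] by (auto intro: add_pos_nonneg)
    have "R + real M * d ?j \<le> R + d i + u"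
      using d[OF i] by (simp add: u_def)
    also have "\<dots> \<le> (R + d i) * (1 + 1 / R * u)"
    proof -
      have "(R + d i) * (1 + 1 / R * u) = R + d i + u + d i * u / R"
        using R by (simp add: field_simps)
      moreover have "d i * u / R \<ge> 0" using d0 u R by simp
      ultimately show ?thesis by simp
    qed
    finally have "(R + real M * d ?j) ^ s \<le> ((R + d i) * (1 + 1 / R * u)) ^ s"
      using Rd by (intro power_mono) auto
    then have "(R + real M * d ?j) ^ s \<le> (R + d i) ^ s * (1 + 1 / R * u) ^ s"
      by (simp only: power_mult_distrib)
    moreover have "1 / x \<le> z * (1 / y)" if "y \<le> x * z" "x > 0" "y > 0" for x y z :: real
      using that by (simp add: field_simps)
    ultimately have "1 / (R + d i) ^ s \<le> (1 + 1 / R * u) ^ s * (1 / (R + real M * d ?j) ^ s)"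
      using Rd by simp
    then have "b * (1 / (R + d i) ^ s) \<le> b * ((1 + 1 / R * u) ^ s * (1 / (R + real M * d ?j) ^ s))"
      using b by (intro mult_left_mono)
    also have "\<dots> = (b * (1 + 1 / R * u) ^ s) * (1 / (R + real M * d ?j) ^ s)"
      by simp
    also have "\<dots> \<le> ((C2 + 1) * (1 / (1 + u)\<^sup>2)) * (1 / (R + real M * d ?j) ^ s)"
    proof (rule mult_right_mono)
      \<comment> \<open>The summand 1 of the chord bound uses the decay of order 2; the other uses
        order \<open>s + 2\<close>, where dividing by \<open>R\<close> leaves at most 1.\<close>
      have "b * (1 + 1 / R * u) ^ s \<le> b * (1 + 1 / R * (1 + u) ^ s)"
        using b u R by (intro mult_left_mono power_one_plus_scaled_le) auto
      then have "b * (1 + 1 / R * u) ^ s * (1 + u)\<^sup>2 \<le> b * (1 + 1 / R * (1 + u) ^ s) * (1 + u)\<^sup>2"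
        by (intro mult_right_mono) auto
      also have "\<dots> = b * (1 + u)\<^sup>2 + b * (1 + u) ^ (s + 2) / R"
        unfolding power_add by (simp add: distrib_left distrib_right)
      also have "\<dots> \<le> C2 + R / R"
        using C2[OF i] Cs[OF i] R unfolding b_def u_def
        by (intro add_mono divide_right_mono) auto
      also have "\<dots> = C2 + 1" using R by simp
      finally show "b * (1 + 1 / R * u) ^ s \<le> (C2 + 1) * (1 / (1 + u)\<^sup>2)"
        using u by (simp add: pos_le_divide_eq)
    qed (use Rd in simp)
    finally show "cmod (B $$ (i, ?j)) * (1 / (R + d i) ^ s)
        \<le> (C2 + 1) * (1 / (1 + \<bar>real i - real (M * l)\<bar>)\<^sup>2) * (1 / (R + real M * d ?j) ^ s)"
      by (simp add: b_def u_def)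
  qed
  also have "\<dots> = (\<Sum>i<K * M. 1 / (1 + \<bar>real i - real (M * l)\<bar>)\<^sup>2)
      * ((C2 + 1) * (1 / (R + real M * d ?j) ^ s))"
    unfolding sum_distrib_right by (intro sum.cong refl) simp
  also have "\<dots> \<le> 4 * ((C2 + 1) * (1 / (R + real M * d ?j) ^ s))"
    using C20 R d0[of ?j] by (intro mult_right_mono sum_inverse_squares_shift_le) auto
  finally show ?thesis by simp
qed

section \<open>Choice of the parameters and the final count\<close>

theorem theorem1:
  fixes M :: nat and \<A> :: "nat set" and chi :: "real \<Rightarrow> real"
  assumes "M \<ge> 2" and "\<A> \<subseteq> {0..<M}" and "\<A> \<noteq> {}" and "cutoff01 chi"
  shows "\<forall>\<nu>>0. \<exists>C K0. \<forall>K\<ge>K0.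
           real (eig_count M \<A> chi K \<nu>)
             \<le> C * real (K * M) powr (ln (real (card \<A>)) / ln (real M))"
proof (intro allI impI)
  fix \<nu> :: real
  define \<delta> where "\<delta> = ln (real (card \<A>)) / ln (real M)"
  define r where "r = real M powr (- \<nu>)"
  have M: "M > 0" and r: "r > 0" using assms(1) by (auto simp: r_def)
  obtain a\<^sub>0 where a\<^sub>0: "a\<^sub>0 \<in> \<A>" using assms(3) by blast
  let ?X = "cantor M \<A> a\<^sub>0"
  obtain C2 where C2: "C2 \<ge> 0" "\<And>K i l a. K > 0 \<Longrightarrow> i < K * M \<Longrightarrow> l < K \<Longrightarrow> a < M \<Longrightarrow>
    cmod (baker M \<A> chi K $$ (i, l + a * K)) * (1 + \<bar>real i - real M * real l\<bar>) ^ 2 \<le> C2"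
    by (rule baker_kernel_decay[OF M assms(2,4), of 2]) blast
  define G where "G = 4 * (C2 + 1)"
  have G: "G > 0" using C2 by (simp add: G_def)
  \<comment> \<open>\<open>G\<close> is fixed before \<open>s\<close>. The ratio 2/3 bounds
    \<open>(R + d j) / (R + M * d j)\<close> for columns with \<open>d j > R\<close>, so this
    \<open>s\<close> makes them small enough for the threshold \<open>r / 6\<close>.\<close>
  obtain s where "(2 / 3) ^ s < r / 6 / G"
    using real_arch_pow_inv[of "r / 6 / G" "2 / 3"] r G by auto
  then have s: "G * (2 / 3) ^ s \<le> r / 6"
    using G by (simp add: field_simps)
  obtain Cs where Cs: "Cs \<ge> 0" "\<And>K i l a. K > 0 \<Longrightarrow> i < K * M \<Longrightarrow> l < K \<Longrightarrow> a < M \<Longrightarrow>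
    cmod (baker M \<A> chi K $$ (i, l + a * K)) * (1 + \<bar>real i - real M * real l\<bar>) ^ (s + 2) \<le> Cs"
    by (rule baker_kernel_decay[OF M assms(2,4), of "s + 2"]) blast
  \<comment> \<open>\<open>R\<close> is chosen after \<open>s\<close>, since it must dominate the
    decay constant of order \<open>s + 2\<close>.\<close>
  define R where "R = max 1 Cs"
  have R: "R \<ge> 1" "Cs \<le> R" by (auto simp: R_def)
  \<comment> \<open>This is the factor obtained from the logarithm of
    \<open>2 ^ count \<le> (1 + 6 * G / r) ^ card S\<close>.\<close>
  define L where "L = ln (1 + 6 * G / r) / ln 2"
  have L: "L \<ge> 0" using G r by (simp add: L_def)
  have "real (eig_count M \<A> chi K \<nu>) \<le> L * (2 * (R + 1 + real M) + 1) * real (K * M) powr \<delta>"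
    if K: "K \<ge> 1" for K
  proof -
    let ?N = "K * M" and ?B = "baker M \<A> chi K"
    define d where "d i = real ?N * infdist (real i / real ?N) ?X" for i :: nat
    define w where "w i = 1 / (R + d i) ^ s" for i
    define S where "S = {j. j < ?N \<and> d j \<le> R}"
    have N: "?N \<ge> 1" using K M by simp
    have K0: "K > 0" using K by simp
    have d0: "d i \<ge> 0" for i by (simp add: d_def infdist_nonneg)
    have w: "w i > 0" for i
      using R d0[of i] by (simp add: w_def)
    have B: "?B \<in> carrier_mat ?N ?N" by (simp add: baker_def)
    have column: "(\<Sum>i<?N. cmod (?B $$ (i,j)) * w i) \<le> G * (1 / (R + real M * d j) ^ s)"
      if j: "j < ?N" for j
    proof -
      define a where "a = j div K"
      define l where "l = j mod K"
      have jla: "j = l + a * K" by (simp add: a_def l_def)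
      have l: "l < K" using K0 by (simp add: l_def)
      have a: "a < M" using j by (simp add: a_def less_mult_imp_div_less mult.commute)
      show ?thesis
      proof (cases "a \<in> \<A>")
        case False
        have chi: "\<And>x. 0 \<le> chi x" using assms(4) by (simp add: cutoff01_def)
        have "cmod (?B $$ (i,j)) = 0" if "i < ?N" for i
          using cmod_baker_index[where chi = chi, OF K0 M assms(2) that l a chi] False jla by simp
        then have "(\<Sum>i<?N. cmod (?B $$ (i,j)) * w i) = 0" by simp
        then show ?thesis using G R d0[of j] by simp
      next
        case True
        have "real M * d j \<le> d i + \<bar>real i - real M * real l\<bar>" for i
        proof -
          \<comment> \<open>In index units the expanding map of block \<open>a\<close> sends
            \<open>l + a * K\<close> to \<open>M * l\<close>, the centre of the column.\<close>
          have x: "real M * (real j / real ?N) - real a = real M * real l / real ?N"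
            using K0 M by (simp add: jla field_simps)
          have "real M * infdist (real j / real ?N) ?X \<le> infdist (real M * real l / real ?N) ?X"
            using infdist_cantor_expanding[OF assms(1,2) a\<^sub>0 True, of "real j / real ?N"] unfolding x .
          also have "\<dots> \<le> infdist (real i / real ?N) ?X + dist (real M * real l / real ?N) (real i / real ?N)"
            by (rule infdist_triangle)
          also have "dist (real M * real l / real ?N) (real i / real ?N) = \<bar>real i - real M * real l\<bar> / real ?N"
            by (simp only: dist_real_def diff_divide_distrib[symmetric] abs_divide abs_of_nat abs_minus_commute)
          finally have "real ?N * (real M * infdist (real j / real ?N) ?X)
              \<le> real ?N * (infdist (real i / real ?N) ?X + \<bar>real i - real M * real l\<bar> / real ?N)"
            by (intro mult_left_mono) auto
          also have "\<dots> = d i + \<bar>real i - real M * real l\<bar>"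
            using K0 M by (simp add: d_def distrib_left)
          finally show ?thesis by (simp add: d_def mult_ac)
        qed
        then show ?thesis
          unfolding w_def G_def jla
          by (intro weighted_column_sum_le[OF R(1) K0 l a C2(2)] order_trans[OF Cs(2) R(2)] d0)
            (use K0 l a in auto)
      qed
    qed
    have Md: "d j \<le> real M * d j" for j
      using d0[of j] M mult_right_mono[of 1 "real M" "d j"] by simp
    have "2 ^ eig_count M \<A> chi K \<nu> \<le> (1 + 6 * G / r) ^ card S"
      unfolding eig_count_def r_def[symmetric]
    proof (rule eigenvalue_count_le[OF B w])
      show "S \<subseteq> {..<?N}" by (auto simp: S_def)
      fix j assume j: "j < ?N"
      have "1 / (R + real M * d j) ^ s \<le> w j"
        unfolding w_def using R d0[of j] Md[of j] by (intro divide_left_mono power_mono) auto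
      then have "G * (1 / (R + real M * d j) ^ s) \<le> G * w j"
        using G by (intro mult_left_mono) auto
      then show "(\<Sum>i<?N. cmod (?B $$ (i,j)) * w i) \<le> G * w j"
        using column[OF j] by linarith
      assume "j \<notin> S"
      then have dj: "d j > R" using j by (simp add: S_def)
      \<comment> \<open>With \<open>M \<ge> 2\<close> and \<open>d j > R\<close>, the inequality
        \<open>3 * (R + d j) \<le> 2 * (R + 2 * d j)\<close> reduces to \<open>R \<le> d j\<close>;
        this is the source of 2/3.\<close>
      have "2 * d j \<le> real M * d j"
        using d0[of j] assms(1) by (intro mult_right_mono) auto
      then have "R + d j \<le> 2 / 3 * (R + real M * d j)"
        using dj by simp
      then have "(R + d j) ^ s \<le> (2 / 3) ^ s * (R + real M * d j) ^ s"
        using R d0[of j] by (simp only: power_mult_distrib[symmetric]) (intro power_mono, auto)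
      then have "1 / (R + real M * d j) ^ s \<le> (2 / 3) ^ s * w j"
        using R d0[of j] Md[of j] by (simp add: w_def field_simps)
      then have "G * (1 / (R + real M * d j) ^ s) \<le> G * ((2 / 3) ^ s * w j)"
        using G by (intro mult_left_mono) auto
      also have "\<dots> \<le> r / 6 * w j"
        using mult_right_mono[OF s, of "w j"] w[of j] by simp
      finally show "(\<Sum>i<?N. cmod (?B $$ (i,j)) * w i) \<le> r / 6 * w j"
        using column[OF j] by linarith
    qed (use G r in auto)
    then have "ln (2 ^ eig_count M \<A> chi K \<nu>) \<le> ln ((1 + 6 * G / r) ^ card S)"
      using G r by (subst ln_le_cancel_iff) (auto intro!: zero_less_power add_pos_pos)
    then have "real (eig_count M \<A> chi K \<nu>) * ln 2 \<le> real (card S) * ln (1 + 6 * G / r)"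
      using G r by (subst (asm) (1 2) ln_realpow) (auto intro!: add_pos_pos)
    then have "real (eig_count M \<A> chi K \<nu>) \<le> L * real (card S)"
      by (simp add: L_def field_simps)
    also have "\<dots> \<le> L * ((2 * (R + 1 + real M) + 1) * real ?N powr \<delta>)"
      unfolding S_def d_def \<delta>_def using R
      by (intro mult_left_mono[OF _ L] card_near_cantor_le[OF assms(1,2) a\<^sub>0 _ N]) auto
    finally show ?thesis by simp
  qed
  then show "\<exists>C K0. \<forall>K\<ge>K0. real (eig_count M \<A> chi K \<nu>)
      \<le> C * real (K * M) powr (ln (real (card \<A>)) / ln (real M))"
    unfolding \<delta>_def by blast
qed

end
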